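(* Let $h\ge 0$ and let $K:\mathbb{R}\to\mathbb{R}$ satisfy $K\ge 0$, $\int_{\mathbb{R}}K(s)e^{\lambda s}ds<\infty$ for all $\lambda\in\mathbb{R}$, and $\int_{\mathbb{R}}K(s)ds=1$. Let $g\in C(\mathbb{R}_+,\mathbb{R}_+)$ satisfy $g(s)>0$ for $s>0$ and suppose that for some $0<\zeta_1<\zeta_2$: 1. $g([\zeta_1,\zeta_2])\subseteq[\zeta_1,\zeta_2]$ and $g([0,\zeta_1])\subseteq[0,\zeta_2]$; 2. $\min_{s\in[\zeta_1,\zeta_2]}g(s)=g(\zeta_1)$; 3. (i) $g(s)>s$ for $s\in(0,\zeta_1]$, and (ii) there exists $p=g'(0)\in(1,+\infty)$; 4. in $\mathbb{R}_+$ the equation $g(s)=s$ has exactly two solutions $0$ and $\kappa$. Let $c_\#\ge0$ be the critical speed defined in the context with $p=g'(0)$ and $q=1$. If $u(t,x)=\phi(x+ct)$, $c>c_\#$, is a positive bounded solution of $$u_t(t,x)=u_{xx}(t,x)-u(t,x)+\int_{\mathbb{R}}K(x-y)g(u(t-h,y))\,dy,$$ then $$\zeta_1\le\liminf_{s\to+\infty}\phi(s)\le\sup_{s\in\mathbb{R}}\phi(s)\le\sup g\big([0,\sup_{s\in\mathbb{R}}\phi(s)]\big).$$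
   Context: Critical speed $c_\#$: for $h\ge0$, $p>q>0$ put $$\psi(z,\epsilon)=\epsilon z^2-z-q+p\,e^{-zh}\int_{\mathbb{R}}K(s)e^{-\sqrt{\epsilon}\,zs}ds .$$ There are uniquely determined extended positive numbers $0<\epsilon_0\le\epsilon_1\le+\infty$, $\epsilon_i=\epsilon_i(h,p,q)$ (depending also on $K$), such that: for $\epsilon\in(0,\epsilon_0)$ the equation $\psi(z,\epsilon)=0$ has exactly two real roots $z$, both positive; for $\epsilon\in(\epsilon_0,\epsilon_1)$, $\psi(z,\epsilon)>0$ for all $z\in\mathbb{R}$; for $\epsilon\in(\epsilon_1,\infty)$ the equation $\psi(z,\epsilon)=0$ has exactly two real roots, both negative. Moreover $\epsilon_0=\epsilon_1$ if and only if both are $+\infty$. Set $c_\#:=1/\sqrt{\epsilon_1}$ (with $1/\sqrt{+\infty}=0$). Solutions are classical; $\mathbb{R}_+=[0,\infty)$. *)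

theory Defs
  imports "HOL-Analysis.Analysis"
begin

definition char_psi :: "real \<Rightarrow> real \<Rightarrow> real \<Rightarrow> (real \<Rightarrow> real) \<Rightarrow> real \<Rightarrow> real \<Rightarrow> real" where
  "char_psi h p q K z \<epsilon> =
     \<epsilon> * z\<^sup>2 - z - q + p * exp (- z * h) * (LINT s|lebesgue. K s * exp (- sqrt \<epsilon> * z * s))"

definition speed_thresholds ::
  "real \<Rightarrow> real \<Rightarrow> real \<Rightarrow> (real \<Rightarrow> real) \<Rightarrow> ereal \<Rightarrow> ereal \<Rightarrow> bool" where
  "speed_thresholds h p q K \<epsilon>\<^sub>0 \<epsilon>\<^sub>1 \<longleftrightarrow>
     0 < \<epsilon>\<^sub>0 \<and> \<epsilon>\<^sub>0 \<le> \<epsilon>\<^sub>1 \<and>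
     (\<forall>\<epsilon>::real. 0 < \<epsilon> \<and> ereal \<epsilon> < \<epsilon>\<^sub>0 \<longrightarrow>
        card {z. char_psi h p q K z \<epsilon> = 0} = 2 \<and> (\<forall>z. char_psi h p q K z \<epsilon> = 0 \<longrightarrow> z > 0)) \<and>
     (\<forall>\<epsilon>::real. \<epsilon>\<^sub>0 < ereal \<epsilon> \<and> ereal \<epsilon> < \<epsilon>\<^sub>1 \<longrightarrow> (\<forall>z. char_psi h p q K z \<epsilon> > 0)) \<and>
     (\<forall>\<epsilon>::real. \<epsilon>\<^sub>1 < ereal \<epsilon> \<longrightarrow>
        card {z. char_psi h p q K z \<epsilon> = 0} = 2 \<and> (\<forall>z. char_psi h p q K z \<epsilon> = 0 \<longrightarrow> z < 0)) \<and>
     (\<epsilon>\<^sub>0 = \<epsilon>\<^sub>1 \<longleftrightarrow> \<epsilon>\<^sub>0 = \<infinity> \<and> \<epsilon>\<^sub>1 = \<infinity>)"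

text \<open>
  For \<open>h \<ge> 0\<close>, \<open>p > q > 0\<close> and a nonnegative kernel \<open>K\<close> of unit mass all of whose exponential
  moments are finite, the thresholds exist and are unique, so the description below is proper.
\<close>

definition upper_threshold :: "real \<Rightarrow> real \<Rightarrow> real \<Rightarrow> (real \<Rightarrow> real) \<Rightarrow> ereal" where
  "upper_threshold h p q K = (THE \<epsilon>\<^sub>1. \<exists>\<epsilon>\<^sub>0. speed_thresholds h p q K \<epsilon>\<^sub>0 \<epsilon>\<^sub>1)"

definition critical_speed :: "real \<Rightarrow> real \<Rightarrow> real \<Rightarrow> (real \<Rightarrow> real) \<Rightarrow> real" where
  "critical_speed h p q K =
     (if upper_threshold h p q K = \<infinity> then 0
      else 1 / sqrt (real_of_ereal (upper_threshold h p q K)))"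

text \<open>
  Entire classical solutions \<open>u t x\<close> of the delayed nonlocal equation: the derivatives
  \<open>ut\<close>, \<open>ux\<close>, \<open>uxx\<close> exist and are jointly continuous, and the equation holds for all
  real \<open>t\<close> and \<open>x\<close>. The values of \<open>g\<close> on the negative half-line are irrelevant for positive \<open>u\<close>.
\<close>

definition classical_solution ::
  "real \<Rightarrow> (real \<Rightarrow> real) \<Rightarrow> (real \<Rightarrow> real) \<Rightarrow> (real \<Rightarrow> real \<Rightarrow> real) \<Rightarrow> bool" where
  "classical_solution h K g u \<longleftrightarrow>
     (\<exists>ut ux uxx :: real \<Rightarrow> real \<Rightarrow> real.
        continuous_on UNIV (\<lambda>(t, x). ut t x) \<and>
        continuous_on UNIV (\<lambda>(t, x). ux t x) \<and>
        continuous_on UNIV (\<lambda>(t, x). uxx t x) \<and>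
        (\<forall>t x. ((\<lambda>\<tau>. u \<tau> x) has_real_derivative ut t x) (at t) \<and>
               ((\<lambda>\<xi>. u t \<xi>) has_real_derivative ux t x) (at x) \<and>
               ((\<lambda>\<xi>. ux t \<xi>) has_real_derivative uxx t x) (at x) \<and>
               ut t x = uxx t x - u t x + (LINT y|lebesgue. K (x - y) * g (u (t - h) y))))"

end

theory Submission imports Defs begin

text \<open>
  With \<open>l = sqrt \<epsilon> * z\<close> and \<open>c = 1 / sqrt \<epsilon>\<close> the characteristic function is strictly convex in \<open>l\<close>;
  for \<open>c\<close> above the critical speed it is positive for all \<open>l \<le> 0\<close>.

  The upper bound is the maximum principle for \<open>\<phi>'' - c \<phi>' - \<phi>\<close>. For the lower bound, positivity for
  \<open>l \<le> 0\<close> yields an exponent \<open>\<mu> \<ge> 0\<close> and a small frequency \<open>\<beta>\<close> such that \<open>e\<^sup>-\<^sup>\<mu>\<^sup>s cos (\<beta> s)\<close> is a strict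
  subsolution of the linearization from a point where it increases up to its zero. Sliding it under the
  profile at the first place where the profile reaches a small level shows that this level is never
  reached, so \<open>\<phi>\<close> stays away from \<open>0\<close> at \<open>+\<infinity>\<close>. Finally \<open>g s \<ge> \<gamma> min s \<zeta>\<^sub>1\<close> with \<open>\<gamma> > 1\<close> on the range of
  \<open>\<phi>\<close>, so by the maximum principle every lower bound below \<open>\<zeta>\<^sub>1\<close> near \<open>+\<infinity>\<close> can be improved by a factor.
\<close>

text \<open>In the linearization at 0, a profile \<open>exp (l * s)\<close> with
  \<open>l \<le> 0\<close> fails to grow towards +\<infinity>. Supercritical \<open>c\<close>
  excludes exactly these exponents, while exponents \<open>l > 0\<close> may remain: the profile may
  well tend to 0 at -\<infinity>. Hence no comparison can be made on the whole line, and the bump is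
  compared with the profile only to the right of a hitting point; to its left, the level itself
  serves as lower bound. Two obstacles shape the bump. The source term is nonlocal, so it also sees
  the cosine outside its central arch, where a second positive arch would spoil the comparison.
  Cutting the kernel to \<open>\<bar>r\<bar> \<le> pi / \<beta>\<close> keeps the argument within
  the central arch and the neighbouring nonpositive half-periods, so the uncut cosine can be
  integrated in closed form and still lies below the source. Moreover \<open>g\<close> is neither
  linear nor monotone; only bounds of the form \<open>p' * min s \<delta>\<close> with
  \<open>p' < p\<close> hold, and only on the range of the profile. The choice
  \<open>p' = p - \<beta>\<close> lets a single parameter \<open>\<beta>\<close> tend to 0 and
  remove window, oscillation and loss of slope together.\<close>

lemma measurable_ident_lebesgue [measurable]: "(\<lambda>x::real. x) \<in> borel_measurable lebesgue"
  by (intro measurable_completion) simp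

section \<open>Kernels with exponential moments\<close>

text \<open>A locale, because the same facts serve \<open>K\<close> and its translate by
  \<open>c * h\<close>, into which the delay is absorbed.\<close>

locale exp_kernel =
  fixes K :: "real \<Rightarrow> real"
  assumes nonneg: "\<And>s. 0 \<le> K s"
    and exp_moments: "\<And>\<mu>::real. integrable lebesgue (\<lambda>s. K s * exp (\<mu> * s))"
    and mass: "(LINT s|lebesgue. K s) = 1"
begin

lemma integrable_kernel: "integrable lebesgue K"
  using exp_moments[of 0] by simp

lemma measurable_kernel [measurable]: "K \<in> borel_measurable lebesgue"
  using integrable_kernel by blast

lemma integrable_exp_abs: "integrable lebesgue (\<lambda>s. K s * exp (a * \<bar>s\<bar>))"
proof (rule Bochner_Integration.integrable_bound)
  show "integrable lebesgue (\<lambda>s. K s * exp (a * s) + K s * exp ((-a) * s))"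
    by (intro Bochner_Integration.integrable_add exp_moments)
  show "(\<lambda>s. K s * exp (a * \<bar>s\<bar>)) \<in> borel_measurable lebesgue"
    by measurable
  show "AE s in lebesgue. norm (K s * exp (a * \<bar>s\<bar>)) \<le> norm (K s * exp (a * s) + K s * exp ((-a) * s))"
  proof (intro AE_I2)
    fix s
    have "exp (a * \<bar>s\<bar>) \<le> exp (a * s) + exp ((-a) * s)"
      by (cases "s \<ge> 0") auto
    then have "K s * exp (a * \<bar>s\<bar>) \<le> K s * (exp (a * s) + exp ((-a) * s))"
      by (intro mult_left_mono nonneg)
    moreover have "0 \<le> K s * exp (a * \<bar>s\<bar>)"
      using nonneg by simp
    ultimately show "norm (K s * exp (a * \<bar>s\<bar>)) \<le> norm (K s * exp (a * s) + K s * exp ((-a) * s))"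
      by (simp add: algebra_simps)
  qed
qed

lemma integrable_times:
  assumes [measurable]: "f \<in> borel_measurable lebesgue"
    and bound: "\<And>s. \<bar>f s\<bar> \<le> C * exp (a * \<bar>s\<bar>)"
  shows "integrable lebesgue (\<lambda>s. K s * f s)"
proof (rule Bochner_Integration.integrable_bound)
  show "integrable lebesgue (\<lambda>s. C * (K s * exp (a * \<bar>s\<bar>)))"
    by (intro integrable_mult_right integrable_exp_abs)
  show "(\<lambda>s. K s * f s) \<in> borel_measurable lebesgue"
    by measurable
  show "AE s in lebesgue. norm (K s * f s) \<le> norm (C * (K s * exp (a * \<bar>s\<bar>)))"
  proof (intro AE_I2)
    fix s
    have "K s * \<bar>f s\<bar> \<le> K s * (C * exp (a * \<bar>s\<bar>))"
      by (intro mult_left_mono bound nonneg)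
    then show "norm (K s * f s) \<le> norm (C * (K s * exp (a * \<bar>s\<bar>)))"
      using nonneg[of s] abs_ge_self[of "C * (K s * exp (a * \<bar>s\<bar>))"] 
      by (simp only: abs_mult real_norm_def) (simp add: algebra_simps)
  qed
qed

lemma integrable_times_bounded:
  assumes "f \<in> borel_measurable lebesgue" "\<And>s. \<bar>f s\<bar> \<le> C"
  shows "integrable lebesgue (\<lambda>s. K s * f s)"
  using integrable_times[of f C 0] assms by simp

lemma integrable_exp_affine: "integrable lebesgue (\<lambda>s. K s * exp (z * (a + b * s)))"
proof (rule integrable_times[of _ "exp (z * a)" "\<bar>z * b\<bar>"])
  fix s
  have "z * b * s \<le> \<bar>z * b\<bar> * \<bar>s\<bar>"
    by (metis abs_ge_self abs_mult)
  then have "z * (a + b * s) \<le> z * a + \<bar>z * b\<bar> * \<bar>s\<bar>"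
    by (simp add: algebra_simps)
  then show "\<bar>exp (z * (a + b * s))\<bar> \<le> exp (z * a) * exp (\<bar>z * b\<bar> * \<bar>s\<bar>)"
    by (simp add: exp_add[symmetric])
qed measurable

text \<open>The factor \<open>exp (z * a)\<close> is kept under the integral: a product of convex
  functions need not be convex, whereas the exponential of a linear function of \<open>z\<close> is
  convex for each \<open>s\<close>.\<close>

lemma convex_exp_affine: "convex_on UNIV (\<lambda>z. LINT s|lebesgue. K s * exp (z * (a + b * s)))"
proof (rule convex_onI)
  fix t x y :: real
  assume t: "0 < t" "t < 1"
  have "(LINT s|lebesgue. K s * exp (((1 - t) * x + t * y) * (a + b * s)))
      \<le> (LINT s|lebesgue. (1 - t) * (K s * exp (x * (a + b * s))) + t * (K s * exp (y * (a + b * s))))"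
  proof (intro integral_mono integrable_exp_affine Bochner_Integration.integrable_add integrable_mult_right)
    fix s
    have "exp ((1 - t) *\<^sub>R (x * (a + b * s)) + t *\<^sub>R (y * (a + b * s)))
        \<le> (1 - t) * exp (x * (a + b * s)) + t * exp (y * (a + b * s))"
      using t by (intro convex_onD[OF exp_convex]) auto
    then have "K s * exp (((1 - t) * x + t * y) * (a + b * s))
        \<le> K s * ((1 - t) * exp (x * (a + b * s)) + t * exp (y * (a + b * s)))"
      by (intro mult_left_mono nonneg) (simp add: algebra_simps)
    then show "K s * exp (((1 - t) * x + t * y) * (a + b * s))
        \<le> (1 - t) * (K s * exp (x * (a + b * s))) + t * (K s * exp (y * (a + b * s)))"
      by (simp add: algebra_simps)
  qed
  also have "\<dots> = (1 - t) * (LINT s|lebesgue. K s * exp (x * (a + b * s)))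
      + t * (LINT s|lebesgue. K s * exp (y * (a + b * s)))"
    by (simp add: integrable_exp_affine)
  finally show "(LINT s|lebesgue. K s * exp (((1 - t) *\<^sub>R x + t *\<^sub>R y) * (a + b * s)))
      \<le> (1 - t) * (LINT s|lebesgue. K s * exp (x * (a + b * s)))
      + t * (LINT s|lebesgue. K s * exp (y * (a + b * s)))"
    by simp
qed simp

text \<open>Continuity comes for free from convexity, since a finite convex function on the whole
  line is continuous.\<close>

lemma continuous_exp_affine: "continuous_on UNIV (\<lambda>z. LINT s|lebesgue. K s * exp (z * (a + b * s)))"
  by (intro convex_on_continuous convex_exp_affine) auto

lemma integral_exp_nonneg: "0 \<le> (LINT s|lebesgue. K s * exp (f s))"
  by (intro integral_nonneg_AE) (simp add: nonneg)

end

section \<open>Real zeros of strictly convex functions\<close>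

definition strictly_convex :: "(real \<Rightarrow> real) \<Rightarrow> bool" where
  "strictly_convex f \<longleftrightarrow>
     (\<forall>x y t. x < y \<longrightarrow> 0 < t \<longrightarrow> t < 1 \<longrightarrow> f ((1 - t) * x + t * y) < (1 - t) * f x + t * f y)"

lemma strictly_convex_between:
  assumes "strictly_convex f" "x < z" "z < y"
  shows "f z < max (f x) (f y)"
proof -
  define t where "t = (z - x) / (y - x)"
  have t: "0 < t" "t < 1"
    using assms unfolding t_def by (auto simp: field_simps)
  have z: "z = (1 - t) * x + t * y"
  proof -
    have "t * (y - x) = z - x"
      using assms unfolding t_def by simp
    then show ?thesis by (simp add: algebra_simps)
  qed
  have "f z < (1 - t) * f x + t * f y"
    using assms(1)[unfolded strictly_convex_def, rule_format, of x y t] assms(2,3) t z by simp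
  also have "\<dots> \<le> (1 - t) * max (f x) (f y) + t * max (f x) (f y)"
    using t by (intro add_mono mult_left_mono) auto
  also have "\<dots> = max (f x) (f y)"
    by (simp add: algebra_simps)
  finally show ?thesis .
qed

lemma strictly_convex_reflect: "strictly_convex f \<Longrightarrow> strictly_convex (\<lambda>z. f (- z))"
  unfolding strictly_convex_def
proof (intro allI impI)
  fix x y t :: real
  assume *: "\<forall>x y t. x < y \<longrightarrow> 0 < t \<longrightarrow> t < 1 \<longrightarrow> f ((1 - t) * x + t * y) < (1 - t) * f x + t * f y"
    and "x < y" "0 < t" "t < 1"
  then show "f (- ((1 - t) * x + t * y)) < (1 - t) * f (- x) + t * f (- y)"
    using *[rule_format, of "- y" "- x" "1 - t"] by (simp add: algebra_simps)
qed

text \<open>The sign pattern +, -, + at \<open>0 < z0 < Z\<close> yields two zeros by the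
  intermediate value theorem; among three zeros the middle one would have a negative value.\<close>

lemma strictly_convex_two_zeros_pos:
  assumes sc: "strictly_convex f" and cont: "continuous_on UNIV f"
    and f0: "0 < f 0" and z0: "0 < z0" "f z0 < 0" and Z: "z0 < Z" "0 < f Z"
  shows "card {z. f z = 0} = 2 \<and> (\<forall>z. f z = 0 \<longrightarrow> 0 < z)"
proof -
  have c: "continuous_on A f" for A
    using cont continuous_on_subset by blast
  obtain a where a: "0 \<le> a" "a \<le> z0" "f a = 0"
    using IVT2'[of f z0 0 0] f0 z0 c by auto
  obtain b where b: "z0 \<le> b" "b \<le> Z" "f b = 0"
    using IVT'[of f z0 0 Z] z0 Z c by auto
  have ab: "0 < a" "a < z0" "z0 < b"
    using a b f0 z0 by (auto simp: order.order_iff_strict)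
  have "z = a \<or> z = b" if "f z = 0" for z
  proof (rule ccontr)
    assume "\<not> (z = a \<or> z = b)"
    then consider "z < a" | "a < z" "z < b" | "b < z"
      by linarith
    then show False
    proof cases
      case 1
      with strictly_convex_between[OF sc, of z a b] a b ab that show ?thesis by simp
    next
      case 2
      with strictly_convex_between[OF sc, of a z b] a b that show ?thesis by simp
    next
      case 3
      with strictly_convex_between[OF sc, of a b z] a b ab that show ?thesis by simp
    qed
  qed
  then have "{z. f z = 0} = {a, b}"
    using a b by auto
  then show ?thesis
    using ab by auto
qed

lemma strictly_convex_two_zeros_neg:
  assumes sc: "strictly_convex f" and cont: "continuous_on UNIV f"
    and f0: "0 < f 0" and z0: "z0 < 0" "f z0 < 0" and Z: "Z < z0" "0 < f Z"
  shows "card {z. f z = 0} = 2 \<and> (\<forall>z. f z = 0 \<longrightarrow> z < 0)"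
proof -
  have "continuous_on UNIV (\<lambda>z. f (- z))"
    by (rule continuous_on_compose2[OF cont]) (auto intro: continuous_intros)
  then have *: "card {z. f (- z) = 0} = 2 \<and> (\<forall>z. f (- z) = 0 \<longrightarrow> 0 < z)"
    using strictly_convex_two_zeros_pos[OF strictly_convex_reflect[OF sc], of "- z0" "- Z"] f0 z0 Z
    by simp
  have "{z. f z = 0} = uminus ` {z. f (- z) = 0}"
  proof (intro equalityI subsetI)
    fix z assume "z \<in> {z. f z = 0}"
    then show "z \<in> uminus ` {z. f (- z) = 0}"
      by (intro image_eqI[of _ _ "- z"]) auto
  qed auto
  then have "card {z. f z = 0} = card {z. f (- z) = 0}"
    by (simp add: card_image)
  moreover have "z < 0" if "f z = 0" for z
    using conjunct2[OF *, rule_format, of "- z"] that by simp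
  ultimately show ?thesis
    using * by simp
qed

section \<open>The critical speed\<close>

lemma inverse_sqrt_less: "0 < a \<Longrightarrow> a < b \<Longrightarrow> 1 / sqrt b < 1 / sqrt a"
  by (simp add: frac_less2)

locale dispersion = exp_kernel +
  fixes h p q :: real
  assumes h_nonneg: "0 \<le> h" and q_pos: "0 < q" and q_less_p: "q < p"
begin

text \<open>
  In the variables \<open>l = sqrt \<epsilon> * z\<close>, \<open>c = 1 / sqrt \<epsilon>\<close> the characteristic function becomes
  strictly monotone in \<open>c\<close>: increasing for \<open>l < 0\<close> and decreasing for \<open>l > 0\<close>.
\<close>

definition disp :: "real \<Rightarrow> real \<Rightarrow> real" where
  "disp l c = l\<^sup>2 - c * l - q + p * exp (- l * c * h) * (LINT s|lebesgue. K s * exp (- l * s))"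

lemma p_pos: "0 < p"
  using q_pos q_less_p by simp

lemma char_psi_disp:
  assumes "0 < \<epsilon>"
  shows "char_psi h p q K z \<epsilon> = disp (sqrt \<epsilon> * z) (1 / sqrt \<epsilon>)"
proof -
  have "(sqrt \<epsilon> * z)\<^sup>2 = \<epsilon> * z\<^sup>2"
    using assms by (simp add: power_mult_distrib)
  moreover have "1 / sqrt \<epsilon> * (sqrt \<epsilon> * z) = z" "- (sqrt \<epsilon> * z) * (1 / sqrt \<epsilon>) * h = - z * h"
    using assms by simp_all
  ultimately show ?thesis
    unfolding char_psi_def disp_def by (simp only:) (simp add: mult.assoc)
qed

lemma disp_zero: "disp 0 c = p - q"
  unfolding disp_def using mass by simp

text \<open>Delay factor and moment merge into one exponential, the form in which convexity and
  continuity are available.\<close>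

lemma disp_alt:
  "disp l c = l\<^sup>2 - c * l - q + p * (LINT s|lebesgue. K s * exp (l * (- c * h + (- 1) * s)))"
proof -
  have "(\<lambda>s. K s * exp (l * (- c * h + (- 1) * s))) = (\<lambda>s. exp (- l * c * h) * (K s * exp (- l * s)))"
    by (auto simp: fun_eq_iff exp_add[symmetric] algebra_simps)
  then show ?thesis
    unfolding disp_def by simp
qed

lemma disp_lower: "l\<^sup>2 - c * l - q \<le> disp l c"
  unfolding disp_alt using integral_exp_nonneg p_pos by simp

lemma continuous_disp: "continuous_on UNIV (\<lambda>l. disp l c)"
  unfolding disp_alt by (intro continuous_intros continuous_exp_affine)

text \<open>Strictness is taken from the square alone; the nonlocal part contributes plain
  convexity.\<close>

lemma strictly_convex_disp: "strictly_convex (\<lambda>l. disp l c)"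
  unfolding strictly_convex_def
proof (intro allI impI)
  fix x y t :: real
  assume t: "x < y" "0 < t" "t < 1"
  define N where "N l = (LINT s|lebesgue. K s * exp (l * (- c * h + (- 1) * s)))" for l
  have "N ((1 - t) * x + t * y) \<le> (1 - t) * N x + t * N y"
    using convex_onD[OF convex_exp_affine, of t x y "- c * h" "- 1"] t unfolding N_def by simp
  then have N: "p * N ((1 - t) * x + t * y) \<le> p * ((1 - t) * N x + t * N y)"
    using p_pos by (intro mult_left_mono) auto
  have "0 < t * (1 - t) * (x - y)\<^sup>2"
    using t by simp
  then have "((1 - t) * x + t * y)\<^sup>2 < (1 - t) * x\<^sup>2 + t * y\<^sup>2"
    by (simp add: power2_eq_square algebra_simps)
  with N show "disp ((1 - t) * x + t * y) c < (1 - t) * disp x c + t * disp y c"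
    unfolding disp_alt N_def[symmetric] by (simp add: algebra_simps)
qed

lemma disp_less_disp_neg: "l < 0 \<Longrightarrow> c < c' \<Longrightarrow> disp l c < disp l c'"
proof -
  assume *: "l < 0" "c < c'"
  have "(- l * c) * h \<le> (- l * c') * h"
    using * h_nonneg by (intro mult_right_mono) auto
  then have "p * exp (- l * c * h) * (LINT s|lebesgue. K s * exp (- l * s))
      \<le> p * exp (- l * c' * h) * (LINT s|lebesgue. K s * exp (- l * s))"
    using p_pos by (intro mult_right_mono mult_left_mono integral_exp_nonneg) auto
  moreover have "c' * l < c * l"
    using * by simp
  ultimately show ?thesis
    unfolding disp_def by simp
qed

lemma disp_less_disp_pos: "0 < l \<Longrightarrow> c < c' \<Longrightarrow> disp l c' < disp l c"
proof -
  assume *: "0 < l" "c < c'"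
  have "(l * c) * h \<le> (l * c') * h"
    using * h_nonneg by (intro mult_right_mono) auto
  then have "p * exp (- l * c' * h) * (LINT s|lebesgue. K s * exp (- l * s))
      \<le> p * exp (- l * c * h) * (LINT s|lebesgue. K s * exp (- l * s))"
    using p_pos by (intro mult_right_mono mult_left_mono integral_exp_nonneg) auto
  moreover have "c * l < c' * l"
    using * by simp
  ultimately show ?thesis
    unfolding disp_def by simp
qed

text \<open>The point 0 lies between \<open>l\<close> and \<open>l'\<close>, and
  \<open>disp 0 c = p - q\<close>. The gap \<open>p - q\<close> is recorded, rather than a mere
  sign, because the separation of the two thresholds is measured against it.\<close>

lemma disp_opposite_signs:
  assumes "l < 0" "0 < l'" "disp l c < 0"
  shows "p - q < disp l' c"
  using strictly_convex_between[OF strictly_convex_disp, of l 0 l' c] assms q_less_p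
  by (auto simp: disp_zero)

text \<open>Negative values are used instead of zeros: they persist under monotone changes of the
  parameter, and together with \<open>disp 0 c > 0\<close> and convexity they force exactly two
  zeros on the same side of 0.\<close>

definition pos_params :: "real set" where
  "pos_params = {\<epsilon>. 0 < \<epsilon> \<and> (\<exists>l>0. disp l (1 / sqrt \<epsilon>) < 0)}"

definition neg_params :: "real set" where
  "neg_params = {\<epsilon>. 0 < \<epsilon> \<and> (\<exists>l<0. disp l (1 / sqrt \<epsilon>) < 0)}"

lemma pos_params_down:
  assumes "b \<in> pos_params" "0 < a" "a < b"
  shows "a \<in> pos_params"
proof -
  obtain l where l: "0 < l" "disp l (1 / sqrt b) < 0"
    using assms(1) unfolding pos_params_def by blast
  have "disp l (1 / sqrt a) < disp l (1 / sqrt b)"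
    by (intro disp_less_disp_pos inverse_sqrt_less l assms)
  also note l(2)
  finally show ?thesis
    unfolding pos_params_def using l(1) assms(2) by blast
qed

lemma neg_params_up:
  assumes "a \<in> neg_params" "a < b"
  shows "b \<in> neg_params"
proof -
  obtain l where l: "0 < a" "l < 0" "disp l (1 / sqrt a) < 0"
    using assms(1) unfolding neg_params_def by blast
  have "disp l (1 / sqrt b) < disp l (1 / sqrt a)"
    by (intro disp_less_disp_neg inverse_sqrt_less l assms)
  also note l(3)
  finally show ?thesis
    unfolding neg_params_def using l(1,2) assms(2) by auto
qed

lemma params_less:
  assumes "a \<in> pos_params" "b \<in> neg_params"
  shows "a < b"
proof (rule ccontr)
  assume "\<not> a < b"
  then have "a \<in> neg_params"
    using neg_params_up[OF assms(2), of a] assms(2) by (cases "a = b") simp_all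
  then obtain l l' where "l < 0" "disp l (1 / sqrt a) < 0" "0 < l'" "disp l' (1 / sqrt a) < 0"
    using assms(1) unfolding pos_params_def neg_params_def by blast
  with disp_opposite_signs[of l l' "1 / sqrt a"] q_less_p show False by simp
qed

text \<open>The nonlocal term is nonnegative, so the square has to beat only
  \<open>c * l + q\<close>. This supplies the far positive value that encloses the outer zero, on
  either side of 0.\<close>

lemma disp_large_pos:
  assumes "\<bar>c\<bar> + q + 1 \<le> \<bar>l\<bar>"
  shows "0 < disp l c"
proof -
  have "c * l \<le> \<bar>c\<bar> * \<bar>l\<bar>"
    by (metis abs_ge_self abs_mult)
  moreover have "(\<bar>c\<bar> + q + 1) * \<bar>l\<bar> \<le> \<bar>l\<bar> * \<bar>l\<bar>"
    using assms by (intro mult_right_mono) auto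
  moreover have "q * 1 \<le> q * \<bar>l\<bar>"
    using assms q_pos by (intro mult_left_mono) auto
  moreover have "0 < \<bar>l\<bar>"
    using assms q_pos by simp
  moreover have "\<bar>l\<bar> * \<bar>l\<bar> = l\<^sup>2"
    by (simp add: power2_eq_square)
  ultimately have "q < l\<^sup>2 - c * l"
    by (simp add: algebra_simps)
  then show ?thesis
    using disp_lower[of l c] by simp
qed

lemma zeros_char_psi:
  assumes "0 < \<epsilon>"
  shows "card {z. char_psi h p q K z \<epsilon> = 0} = card {l. disp l (1 / sqrt \<epsilon>) = 0}"
proof -
  have "{l. disp l (1 / sqrt \<epsilon>) = 0} = (\<lambda>z. sqrt \<epsilon> * z) ` {z. char_psi h p q K z \<epsilon> = 0}"
  proof (intro equalityI subsetI)
    fix l assume "l \<in> {l. disp l (1 / sqrt \<epsilon>) = 0}"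
    then show "l \<in> (\<lambda>z. sqrt \<epsilon> * z) ` {z. char_psi h p q K z \<epsilon> = 0}"
      using assms by (intro image_eqI[of _ _ "l / sqrt \<epsilon>"]) (auto simp: char_psi_disp)
  qed (use assms in \<open>auto simp: char_psi_disp\<close>)
  moreover have "inj_on (\<lambda>z. sqrt \<epsilon> * z) A" for A
    using assms by (auto simp: inj_on_def)
  ultimately show ?thesis
    by (simp add: card_image)
qed

lemma zeros_pos_params:
  assumes "\<epsilon> \<in> pos_params"
  shows "card {z. char_psi h p q K z \<epsilon> = 0} = 2 \<and> (\<forall>z. char_psi h p q K z \<epsilon> = 0 \<longrightarrow> 0 < z)"
proof -
  obtain l where *: "0 < \<epsilon>" "0 < l" "disp l (1 / sqrt \<epsilon>) < 0"
    using assms unfolding pos_params_def by auto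
  let ?Z = "\<bar>1 / sqrt \<epsilon>\<bar> + q + 1 + l"
  have Z: "l < ?Z" "0 < disp ?Z (1 / sqrt \<epsilon>)"
    using *(2) q_pos by (auto intro!: disp_large_pos simp del: abs_divide)
  have "card {l. disp l (1 / sqrt \<epsilon>) = 0} = 2 \<and> (\<forall>l. disp l (1 / sqrt \<epsilon>) = 0 \<longrightarrow> 0 < l)"
    using strictly_convex_two_zeros_pos[OF strictly_convex_disp continuous_disp _ *(2,3) Z] q_less_p
    by (simp add: disp_zero)
  then show ?thesis
    using * zeros_char_psi[of \<epsilon>] by (auto simp: char_psi_disp zero_less_mult_iff)
qed

lemma zeros_neg_params:
  assumes "\<epsilon> \<in> neg_params"
  shows "card {z. char_psi h p q K z \<epsilon> = 0} = 2 \<and> (\<forall>z. char_psi h p q K z \<epsilon> = 0 \<longrightarrow> z < 0)"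
proof -
  obtain l where *: "0 < \<epsilon>" "l < 0" "disp l (1 / sqrt \<epsilon>) < 0"
    using assms unfolding neg_params_def by auto
  let ?Z = "- (\<bar>1 / sqrt \<epsilon>\<bar> + q + 1) + l"
  have Z: "?Z < l" "0 < disp ?Z (1 / sqrt \<epsilon>)"
    using *(2) q_pos by (auto intro!: disp_large_pos simp del: abs_divide)
  have "card {l. disp l (1 / sqrt \<epsilon>) = 0} = 2 \<and> (\<forall>l. disp l (1 / sqrt \<epsilon>) = 0 \<longrightarrow> l < 0)"
    using strictly_convex_two_zeros_neg[OF strictly_convex_disp continuous_disp _ *(2,3) Z] q_less_p
    by (simp add: disp_zero)
  then show ?thesis
    using * zeros_char_psi[of \<epsilon>] by (auto simp: char_psi_disp mult_less_0_iff)
qed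

lemma pos_params_nonempty: "\<exists>\<epsilon>. \<epsilon> \<in> pos_params"
proof -
  define J where "J = (LINT s|lebesgue. K s * exp (- 1 * s))"
  have J: "0 \<le> J"
    unfolding J_def by (rule integral_exp_nonneg)
  \<comment> \<open>At \<open>l = 1\<close> the delay factor is at most 1, so this speed gives
    \<open>disp 1 c \<le> - 1 - q\<close>.\<close>
  define c where "c = 2 + p * J"
  have c: "0 < c"
    using J p_pos by (simp add: c_def add_pos_nonneg)
  have "exp (- 1 * c * h) \<le> 1"
    using c h_nonneg by simp
  then have "p * exp (- 1 * c * h) * J \<le> p * 1 * J"
    using J p_pos by (intro mult_right_mono mult_left_mono) auto
  then have "disp 1 c < 0"
    unfolding disp_def J_def[symmetric] using q_pos by (simp add: c_def)
  moreover have "1 / sqrt (1 / c\<^sup>2) = c"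
    using c by (simp add: real_sqrt_divide)
  ultimately have "1 / c\<^sup>2 \<in> pos_params"
    unfolding pos_params_def using c by (auto intro!: exI[of _ 1])
  then show ?thesis by blast
qed

text \<open>An empty \<open>neg_params\<close> makes the infimum \<open>upper_param\<close> equal to
  \<infinity>, the case of critical speed 0.\<close>

definition lower_param :: ereal where "lower_param = (SUP \<epsilon>\<in>pos_params. ereal \<epsilon>)"
definition upper_param :: ereal where "upper_param = (INF \<epsilon>\<in>neg_params. ereal \<epsilon>)"

lemma pos_paramsI: "0 < \<epsilon> \<Longrightarrow> ereal \<epsilon> < lower_param \<Longrightarrow> \<epsilon> \<in> pos_params"
  unfolding lower_param_def less_SUP_iff using pos_params_down by auto

lemma neg_paramsI: "upper_param < ereal \<epsilon> \<Longrightarrow> \<epsilon> \<in> neg_params"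
  unfolding upper_param_def INF_less_iff using neg_params_up by auto

lemma pos_paramsD: "\<epsilon> \<in> pos_params \<Longrightarrow> ereal \<epsilon> \<le> lower_param"
  unfolding lower_param_def by (rule SUP_upper)

lemma neg_paramsD: "\<epsilon> \<in> neg_params \<Longrightarrow> upper_param \<le> ereal \<epsilon>"
  unfolding upper_param_def by (rule INF_lower)

lemma lower_param_pos: "0 < lower_param"
proof -
  obtain \<epsilon> where \<epsilon>: "\<epsilon> \<in> pos_params"
    using pos_params_nonempty by blast
  then have "0 < ereal \<epsilon>"
    by (simp add: pos_params_def)
  also have "\<dots> \<le> lower_param"
    using \<epsilon> by (rule pos_paramsD)
  finally show ?thesis .
qed

lemma lower_le_upper_param: "lower_param \<le> upper_param"
  unfolding lower_param_def upper_param_def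
  using params_less by (intro SUP_least INF_greatest) (auto intro: less_imp_le)

text \<open>A value \<open>\<le> 0\<close> at \<open>\<epsilon>\<close> becomes strictly negative at
  a slightly larger parameter, still below the infimum of \<open>neg_params\<close>. Strict
  monotonicity thus excludes zeros as well as negative values.\<close>

lemma disp_pos_of_neg_arg:
  assumes \<epsilon>: "0 < \<epsilon>" "ereal \<epsilon> < upper_param" and l: "l \<le> 0"
  shows "0 < disp l (1 / sqrt \<epsilon>)"
proof (rule ccontr)
  assume neg: "\<not> 0 < disp l (1 / sqrt \<epsilon>)"
  then have "l < 0"
    using l q_less_p by (cases "l = 0") (auto simp: disp_zero)
  obtain \<epsilon>' where \<epsilon>': "ereal \<epsilon> < ereal \<epsilon>'" "ereal \<epsilon>' < upper_param"
    using ereal_dense2[OF \<epsilon>(2)] by auto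
  have "disp l (1 / sqrt \<epsilon>') < disp l (1 / sqrt \<epsilon>)"
    using \<open>l < 0\<close> \<epsilon> \<epsilon>' by (intro disp_less_disp_neg inverse_sqrt_less) auto
  then have "\<epsilon>' \<in> neg_params"
    unfolding neg_params_def using neg \<open>l < 0\<close> \<epsilon> \<epsilon>' by (auto intro!: exI[of _ l])
  then show False
    using neg_paramsD \<epsilon>'(2) by (meson leD)
qed

lemma disp_pos_of_pos_arg:
  assumes \<epsilon>: "lower_param < ereal \<epsilon>" and l: "0 \<le> l"
  shows "0 < disp l (1 / sqrt \<epsilon>)"
proof (rule ccontr)
  assume neg: "\<not> 0 < disp l (1 / sqrt \<epsilon>)"
  then have "0 < l"
    using l q_less_p by (cases "l = 0") (auto simp: disp_zero)
  obtain \<epsilon>' where \<epsilon>': "lower_param < ereal \<epsilon>'" "ereal \<epsilon>' < ereal \<epsilon>"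
    using ereal_dense2[OF \<epsilon>] by auto
  have "0 < ereal \<epsilon>'"
    using lower_param_pos \<epsilon>'(1) by (rule order.strict_trans)
  then have "0 < \<epsilon>'"
    by simp
  have "disp l (1 / sqrt \<epsilon>') < disp l (1 / sqrt \<epsilon>)"
    using \<open>0 < l\<close> \<open>0 < \<epsilon>'\<close> \<epsilon>' by (intro disp_less_disp_pos inverse_sqrt_less) auto
  then have "\<epsilon>' \<in> pos_params"
    unfolding pos_params_def using neg \<open>0 < l\<close> \<open>0 < \<epsilon>'\<close> by (auto intro!: exI[of _ l])
  then show False
    using pos_paramsD \<epsilon>'(1) by (meson leD)
qed

text \<open>At a common finite threshold with speed \<open>c\<close>, the speed
  \<open>c + \<delta>\<close> has a negative value at some \<open>l > 0\<close> and
  \<open>c - \<delta>\<close> one at some \<open>l' < 0\<close>. The latter forces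
  \<open>disp l (c - \<delta>) > p - q\<close>, although \<open>l\<close> stays bounded and the
  speed has moved by only \<open>2 * \<delta>\<close>.\<close>

lemma lower_less_upper_param:
  assumes "upper_param \<noteq> \<infinity>"
  shows "lower_param \<noteq> upper_param"
proof
  assume eq: "lower_param = upper_param"
  obtain e where e: "upper_param = ereal e"
    using assms lower_param_pos lower_le_upper_param by (cases upper_param) auto
  have "0 < e"
    using lower_param_pos eq e by simp
  define c where "c = 1 / sqrt e"
  have c: "0 < c"
    using \<open>0 < e\<close> by (simp add: c_def)
  \<comment> \<open>For \<open>\<delta> < 1\<close>, \<open>disp_large_pos\<close> at speed
    \<open>c + \<delta>\<close> confines the point \<open>l\<close> to
    \<open>[0, R]\<close>.\<close>
  define R where "R = c + q + 2"
  have R: "0 \<le> R"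
    using c q_pos by (simp add: R_def)
  \<comment> \<open>A bound for \<open>disp l (c - \<delta>)\<close> that tends to 0 with
    \<open>\<delta>\<close>. The factor \<open>q + R * R\<close> bounds the nonlocal term at speed
    \<open>c + \<delta>\<close>, where the negativity of \<open>disp\<close> controls it.\<close>
  define b where "b \<delta> = 2 * \<delta> * R + (q + R * R) * (exp (R * (2 * \<delta>) * h) - 1)" for \<delta> :: real
  have bound: "p - q \<le> b \<delta>" if \<delta>: "0 < \<delta>" "\<delta> < c" "\<delta> < 1" for \<delta>
  proof -
    have sqrt_inv: "1 / sqrt (1 / x\<^sup>2) = x" if "0 < x" for x :: real
      using that by (simp add: real_sqrt_divide)
    have e_c: "e = 1 / c\<^sup>2"
      using \<open>0 < e\<close> by (simp add: c_def power_divide)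
    have "1 / (c + \<delta>)\<^sup>2 < e"
      unfolding e_c using c \<delta> by (intro divide_strict_left_mono power_strict_mono) auto
    then have "1 / (c + \<delta>)\<^sup>2 \<in> pos_params"
      using eq e c \<delta> by (intro pos_paramsI) auto
    then obtain l where l: "0 < l" "disp l (c + \<delta>) < 0"
      using sqrt_inv[of "c + \<delta>"] c \<delta> unfolding pos_params_def by auto
    have "e < 1 / (c - \<delta>)\<^sup>2"
      unfolding e_c using c \<delta> by (intro divide_strict_left_mono power_strict_mono) auto
    then have "1 / (c - \<delta>)\<^sup>2 \<in> neg_params"
      using e by (intro neg_paramsI) auto
    then obtain l' where l': "l' < 0" "disp l' (c - \<delta>) < 0"
      using sqrt_inv[of "c - \<delta>"] \<delta> unfolding neg_params_def by auto
    have lR: "l \<le> R"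
      using disp_large_pos[of "c + \<delta>" l] l c \<delta> unfolding R_def by linarith
    define J where "J = p * (LINT s|lebesgue. K s * exp (- l * s))"
    have J: "0 \<le> J"
      unfolding J_def using p_pos by (intro mult_nonneg_nonneg integral_exp_nonneg) auto
    have d: "disp l x = l\<^sup>2 - x * l - q + J * exp (- l * x * h)" for x
      unfolding disp_def J_def by simp
    have "J * exp (- l * (c + \<delta>) * h) \<le> q + (c + \<delta>) * l - l\<^sup>2"
      using l(2) d by simp
    also have "\<dots> \<le> q + (c + \<delta>) * l"
      by simp
    also have "\<dots> \<le> q + R * R"
      using lR R c \<delta> l q_pos by (intro add_left_mono mult_mono) (auto simp: R_def)
    finally have Jb: "J * exp (- l * (c + \<delta>) * h) \<le> q + R * R" .
    have "l * (2 * \<delta>) * h \<le> R * (2 * \<delta>) * h"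
      using lR \<delta> h_nonneg by (intro mult_right_mono) auto
    then have "exp (l * (2 * \<delta>) * h) - 1 \<le> exp (R * (2 * \<delta>) * h) - 1"
      by simp
    moreover have "0 \<le> exp (l * (2 * \<delta>) * h) - 1"
      using l \<delta> h_nonneg by simp
    ultimately have Jm: "J * exp (- l * (c + \<delta>) * h) * (exp (l * (2 * \<delta>) * h) - 1)
        \<le> (q + R * R) * (exp (R * (2 * \<delta>) * h) - 1)"
      using Jb q_pos R by (intro mult_mono) auto
    have "exp (- l * (c - \<delta>) * h) = exp (- l * (c + \<delta>) * h) * exp (l * (2 * \<delta>) * h)"
      by (simp add: exp_add[symmetric] algebra_simps)
    then have "disp l (c - \<delta>) = disp l (c + \<delta>) + 2 * \<delta> * l
        + J * exp (- l * (c + \<delta>) * h) * (exp (l * (2 * \<delta>) * h) - 1)"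
      unfolding d by (simp add: algebra_simps)
    moreover have "2 * \<delta> * l \<le> 2 * \<delta> * R"
      using lR \<delta> by simp
    ultimately have "disp l (c - \<delta>) \<le> b \<delta>"
      unfolding b_def using Jm l(2) by linarith
    with disp_opposite_signs[OF l'(1) l(1) l'(2)] show ?thesis
      by simp
  qed
  have "(b \<longlongrightarrow> b 0) (at_right 0)"
    unfolding b_def by (intro tendsto_intros)
  moreover have "eventually (\<lambda>\<delta>. p - q \<le> b \<delta>) (at_right 0)"
    unfolding eventually_at_right_field using bound c by (intro exI[of _ "min c 1"]) auto
  ultimately have "p - q \<le> b 0"
    by (intro tendsto_lowerbound[of b]) auto
  then show False
    using q_less_p by (simp add: b_def)
qed

lemma speed_thresholds_params: "speed_thresholds h p q K lower_param upper_param"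
  unfolding speed_thresholds_def
proof (intro conjI[of "0 < lower_param"] conjI[of "lower_param \<le> upper_param"] conjI[rotated] lower_param_pos lower_le_upper_param)
  show "\<forall>\<epsilon>. 0 < \<epsilon> \<and> ereal \<epsilon> < lower_param \<longrightarrow> card {z. char_psi h p q K z \<epsilon> = 0} = 2 \<and> (\<forall>z. char_psi h p q K z \<epsilon> = 0 \<longrightarrow> 0 < z)"
    using zeros_pos_params pos_paramsI by blast
  show "\<forall>\<epsilon>. upper_param < ereal \<epsilon> \<longrightarrow> card {z. char_psi h p q K z \<epsilon> = 0} = 2 \<and> (\<forall>z. char_psi h p q K z \<epsilon> = 0 \<longrightarrow> z < 0)"
    using zeros_neg_params neg_paramsI by blast
  show "\<forall>\<epsilon>. lower_param < ereal \<epsilon> \<and> ereal \<epsilon> < upper_param \<longrightarrow> (\<forall>z. 0 < char_psi h p q K z \<epsilon>)"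
  proof (intro allI impI)
    fix \<epsilon> z assume *: "lower_param < ereal \<epsilon> \<and> ereal \<epsilon> < upper_param"
    then have "0 < ereal \<epsilon>"
      using lower_param_pos by (metis order.strict_trans)
    then have \<epsilon>: "0 < \<epsilon>"
      by simp
    show "0 < char_psi h p q K z \<epsilon>"
    proof (cases "0 \<le> z")
      case True
      then show ?thesis
        using * \<epsilon> by (simp add: char_psi_disp disp_pos_of_pos_arg)
    next
      case False
      then have "sqrt \<epsilon> * z \<le> 0"
        using \<epsilon> by (simp add: mult_nonneg_nonpos)
      then show ?thesis
        using * \<epsilon> by (simp add: char_psi_disp disp_pos_of_neg_arg)
    qed
  qed
  show "lower_param = upper_param \<longleftrightarrow> lower_param = \<infinity> \<and> upper_param = \<infinity>"
    using lower_less_upper_param by (cases "upper_param = \<infinity>") simp_all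
qed

text \<open>Between two different upper thresholds one description yields a negative zero, while the
  other allows only positive zeros or none. Used in both directions, this gives the uniqueness that
  \<open>THE\<close> requires.\<close>

lemma speed_thresholds_upper_le:
  assumes "speed_thresholds h p q K a b" "speed_thresholds h p q K a' b'"
  shows "b' \<le> b"
proof (rule ccontr)
  assume "\<not> b' \<le> b"
  then have "b < b'"
    by simp
  have pos: "0 < b"
    using assms(1) unfolding speed_thresholds_def by (meson order.strict_trans2)
  obtain x where x: "b < ereal x" "ereal x < b'"
    using ereal_dense2[OF \<open>b < b'\<close>] by auto
  obtain y where y: "b < ereal y" "ereal y < ereal x"
    using ereal_dense2[OF x(1)] by auto
  \<comment> \<open>The value \<open>a'\<close> must be avoided, since the description says nothing
    about the parameter at a threshold itself.\<close>
  obtain \<epsilon> where \<epsilon>: "b < ereal \<epsilon>" "ereal \<epsilon> < b'" "ereal \<epsilon> \<noteq> a'"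
  proof (cases "ereal x = a'")
    case True
    have "ereal y < b'"
      using y(2) x(2) by (rule order.strict_trans)
    then show ?thesis
      using that[of y] y True by auto
  qed (use that[of x] x in auto)
  have "0 < ereal \<epsilon>"
    using pos \<epsilon>(1) by (rule order.strict_trans)
  then have "0 < \<epsilon>"
    by simp
  have neg: "card {z. char_psi h p q K z \<epsilon> = 0} = 2 \<and> (\<forall>z. char_psi h p q K z \<epsilon> = 0 \<longrightarrow> z < 0)"
    using assms(1) \<epsilon>(1) unfolding speed_thresholds_def by blast
  then have "{z. char_psi h p q K z \<epsilon> = 0} \<noteq> {}"
    by (metis card.empty zero_neq_numeral)
  then obtain z where z: "char_psi h p q K z \<epsilon> = 0" "z < 0"
    using neg by blast
  consider "ereal \<epsilon> < a'" | "a' < ereal \<epsilon>"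
    using \<epsilon>(3) by fastforce
  then show False
  proof cases
    case 1
    then have "0 < z"
      using assms(2) z(1) \<open>0 < \<epsilon>\<close> unfolding speed_thresholds_def by blast
    with z(2) show False by simp
  next
    case 2
    then have "0 < char_psi h p q K z \<epsilon>"
      using assms(2) \<epsilon>(2) unfolding speed_thresholds_def by blast
    with z(1) show False by simp
  qed
qed

lemma upper_threshold_eq: "upper_threshold h p q K = upper_param"
  unfolding upper_threshold_def
proof (rule the_equality)
  show "\<exists>\<epsilon>\<^sub>0. speed_thresholds h p q K \<epsilon>\<^sub>0 upper_param"
    using speed_thresholds_params by blast
  show "b = upper_param" if "\<exists>a. speed_thresholds h p q K a b" for b
    using that speed_thresholds_upper_le speed_thresholds_params by (meson order_antisym)
qed

text \<open>The inequality for \<open>c\<close> turns into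
  \<open>1 / c\<^sup>2 < upper_param\<close>, which also covers an infinite threshold. Only
  \<open>l \<le> 0\<close> is claimed: for large speeds \<open>disp\<close> does take negative
  values at positive \<open>l\<close>.\<close>

lemma
  assumes "critical_speed h p q K < c"
  shows supercritical_speed_pos: "0 < c"
    and supercritical_disp_pos: "l \<le> 0 \<Longrightarrow> 0 < disp l c"
proof -
  have pos: "0 < upper_param"
    using lower_param_pos lower_le_upper_param by (rule order.strict_trans2)
  have *: "0 < c \<and> ereal (1 / c\<^sup>2) < upper_param"
  proof (cases "upper_param = \<infinity>")
    case True
    then show ?thesis
      using assms by (simp add: critical_speed_def upper_threshold_eq)
  next
    case False
    then obtain e where e: "upper_param = ereal e"
      using pos by (cases upper_param) auto
    then have e0: "0 < e"
      using pos by simp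
    have ec: "1 / sqrt e < c"
      using assms e by (simp add: critical_speed_def upper_threshold_eq)
    have c: "0 < c"
      by (rule order.strict_trans[OF _ ec]) (use e0 in simp)
    have "(1 / sqrt e)\<^sup>2 < c\<^sup>2"
      using ec e0 by (intro power_strict_mono) auto
    then have "1 / e < c\<^sup>2"
      using e0 by (simp add: power_divide)
    then have "1 / c\<^sup>2 < e"
      using e0 c by (simp add: field_simps)
    then show ?thesis
      using e c by simp
  qed
  then show "0 < c"
    by simp
  assume "l \<le> 0"
  have "1 / sqrt (1 / c\<^sup>2) = c"
    using * by (simp add: real_sqrt_divide)
  with disp_pos_of_neg_arg[of "1 / c\<^sup>2" l] * \<open>l \<le> 0\<close> show "0 < disp l c"
    by simp
qed

end

section \<open>A maximum principle on half-lines\<close>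

lemma
  fixes f f' :: "real \<Rightarrow> real"
  assumes d1: "\<And>s. a < s \<Longrightarrow> s < b \<Longrightarrow> (f has_real_derivative f' s) (at s)"
    and d2: "(f' has_real_derivative D) (at x)"
    and x: "a < x" "x < b"
    and min: "\<And>s. a < s \<Longrightarrow> s < b \<Longrightarrow> f x \<le> f s"
  shows first_derivative_at_min: "f' x = 0" and second_derivative_at_min: "0 \<le> D"
proof -
  define e where "e = Min {x - a, b - x}"
  have e: "0 < e" "e \<le> x - a" "e \<le> b - x"
    using x by (auto simp: e_def)
  show "f' x = 0"
    by (rule DERIV_local_min[OF d1[OF x] e(1)]) (use e min in \<open>auto simp: abs_less_iff\<close>)
  show "0 \<le> D"
  proof (rule ccontr)
    assume "\<not> 0 \<le> D"
    then obtain d where d: "0 < d" "\<And>t. 0 < t \<Longrightarrow> t < d \<Longrightarrow> f' (x + t) < f' x"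
      using DERIV_neg_dec_right[OF d2] by auto
    define t where "t = min d e / 2"
    have t: "0 < t" "t < d" "t < e"
      using d e by (auto simp: t_def)
    obtain y where y: "x < y" "y < x + t" "f (x + t) - f x = (x + t - x) * f' y"
    proof (rule exE[OF MVT2[of x "x + t" f f']])
      show "x < x + t"
        using t by simp
      show "DERIV f y :> f' y" if "x \<le> y" "y \<le> x + t" for y
        using that t e x by (intro d1) auto
    qed (use that in auto)
    have "f' y < 0"
      using d(2)[of "y - x"] y t \<open>f' x = 0\<close> by simp
    then have "f (x + t) < f x"
      using y t mult_pos_neg[of t "f' y"] by simp
    moreover have "f x \<le> f (x + t)"
      using t e x by (intro min) auto
    ultimately show False
      by simp
  qed
qed

text \<open>The condition on \<open>\<nu>\<close> makes \<open>C * exp (- \<nu> * (s - A))\<close> a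
  supersolution. It dominates \<open>f\<close> at \<open>A\<close>, and boundedness of
  \<open>f\<close> replaces a boundary condition at +\<infinity>.\<close>

lemma max_principle_half_line:
  fixes f f' f'' :: "real \<Rightarrow> real"
  assumes c: "0 \<le> c" and \<nu>: "\<nu>\<^sup>2 + c * \<nu> \<le> 1"
    and d1: "\<And>s. (f has_real_derivative f' s) (at s)"
    and d2: "\<And>s. (f' has_real_derivative f'' s) (at s)"
    and sub: "\<And>s. A < s \<Longrightarrow> 0 \<le> f'' s - c * f' s - f s"
    and C: "0 \<le> C" "\<And>s. f s \<le> C"
    and s: "A \<le> s"
  shows "f s \<le> C * exp (- \<nu> * (s - A))"
proof -
  have claim: "f s \<le> C * exp (- \<nu> * (s - A)) + \<delta> * (s - A)" if "0 < \<delta>" for \<delta>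
  proof (rule ccontr)
    assume neg: "\<not> ?thesis"
    \<comment> \<open>The linear term is also a supersolution because \<open>c \<ge> 0\<close>, and
      it exceeds the bound \<open>C\<close> from the point \<open>B\<close> below onwards. Hence a
      negative value of \<open>v\<close> leads to a negative interior minimum on
      \<open>[A, B]\<close>.\<close>
    define v where "v s = C * exp (- \<nu> * (s - A)) + \<delta> * (s - A) - f s" for s
    define v' where "v' s = - \<nu> * (C * exp (- \<nu> * (s - A))) + \<delta> - f' s" for s
    define v'' where "v'' s = \<nu>\<^sup>2 * (C * exp (- \<nu> * (s - A))) - f'' s" for s
    have v: "(v has_real_derivative v' s) (at s)" for s
      unfolding v_def v'_def by (auto intro!: derivative_eq_intros d1)
    have v': "(v' has_real_derivative v'' s) (at s)" for s
      unfolding v'_def v''_def by (auto intro!: derivative_eq_intros d2 simp: power2_eq_square)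
    define B where "B = A + C / \<delta>"
    have vB: "0 \<le> v t" if "B \<le> t" for t
    proof -
      have "C \<le> \<delta> * (t - A)"
        using that \<open>0 < \<delta>\<close> by (simp add: B_def field_simps)
      then show ?thesis
        using C(2)[of t] mult_nonneg_nonneg[OF C(1), of "exp (- \<nu> * (t - A))"]
        unfolding v_def by (smt (verit) exp_ge_zero)
    qed
    have "v s < 0"
      using neg by (simp add: v_def)
    then have "s < B"
      using vB[of s] by linarith
    have "continuous_on {A..B} v"
      using v by (intro DERIV_continuous_on[of _ v v']) (auto intro: has_field_derivative_at_within)
    then obtain x where x: "x \<in> {A..B}" "\<And>t. t \<in> {A..B} \<Longrightarrow> v x \<le> v t"
      using continuous_attains_inf[of "{A..B}" v] s \<open>s < B\<close> by auto
    have vx: "v x < 0"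
      using x(2)[of s] s \<open>s < B\<close> \<open>v s < 0\<close> by simp
    have "0 \<le> v A"
      using C(2)[of A] by (simp add: v_def)
    then have xx: "A < x" "x < B"
      using x vx vB[of B] by (auto simp: order.order_iff_strict)
    have min: "v x \<le> v t" if "A < t" "t < B" for t
      using that x(2)[of t] by simp
    have "v' x = 0" "0 \<le> v'' x"
      by (rule first_derivative_at_min[OF v v' xx min] second_derivative_at_min[OF v v' xx min]; assumption)+
    then have "0 < v'' x - c * v' x - v x"
      using vx by simp
    also have "\<dots> = - (f'' x - c * f' x - f x) - (1 - \<nu>\<^sup>2 - c * \<nu>) * (C * exp (- \<nu> * (x - A)))
        - \<delta> * (c + (x - A))"
      by (simp add: v_def v'_def v''_def algebra_simps)
    also have "\<dots> \<le> 0"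
    proof -
      have "0 \<le> (1 - \<nu>\<^sup>2 - c * \<nu>) * (C * exp (- \<nu> * (x - A)))"
        using \<nu> C(1) by (intro mult_nonneg_nonneg) auto
      moreover have "0 \<le> \<delta> * (c + (x - A))"
        using c xx \<open>0 < \<delta>\<close> by simp
      ultimately show ?thesis
        using sub[OF xx(1)] by linarith
    qed
    finally show False
      by simp
  qed
  show ?thesis
  proof (rule field_le_epsilon)
    fix e :: real assume "0 < e"
    define \<delta> where "\<delta> = e / (s - A + 1)"
    have "\<delta> * (s - A) \<le> \<delta> * (s - A + 1)"
      using s \<open>0 < e\<close> by (intro mult_left_mono) (auto simp: \<delta>_def)
    also have "\<dots> = e"
      using s by (simp add: \<delta>_def)
    finally show "f s \<le> C * exp (- \<nu> * (s - A)) + e"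
      using claim[of \<delta>] s \<open>0 < e\<close> by (simp add: \<delta>_def)
  qed
qed

section \<open>Lower bounds for the birth function\<close>

text \<open>Near 0 the derivative gives \<open>p' * s \<le> g s\<close>; on the rest of
  \<open>[0, S]\<close> the function has a positive minimum. Capping at \<open>\<delta>\<close>
  brings the linear bound below that minimum without requiring monotonicity of
  \<open>g\<close>.\<close>

lemma lower_bound_from_derivative:
  fixes g :: "real \<Rightarrow> real"
  assumes cont: "continuous_on {0..} g" and g0: "g 0 = 0" and pos: "\<And>s. 0 < s \<Longrightarrow> 0 < g s"
    and deriv: "(g has_real_derivative p) (at 0 within {0..})" and p': "0 < p'" "p' < p"
  shows "\<exists>\<delta>>0. \<forall>s\<in>{0..S}. p' * min s \<delta> \<le> g s"
proof -
  have "((\<lambda>s. g s / s) \<longlongrightarrow> p) (at 0 within {0..})"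
    using deriv g0 by (simp add: has_field_derivative_iff)
  then have "eventually (\<lambda>s. p' < g s / s) (at 0 within {0..})"
    using p'(2) by (rule order_tendstoD)
  then obtain d where d: "0 < d" "\<And>s. s \<in> {0..} \<Longrightarrow> s \<noteq> 0 \<Longrightarrow> dist s 0 < d \<Longrightarrow> p' < g s / s"
    unfolding eventually_at by blast
  define \<delta>0 where "\<delta>0 = d / 2"
  have near: "p' * s \<le> g s" if "0 \<le> s" "s \<le> \<delta>0" for s
  proof (cases "s = 0")
    case False
    then have "p' < g s / s" "0 < s"
      using that d by (auto simp: \<delta>0_def dist_real_def)
    then show ?thesis
      by (simp add: field_simps)
  qed (simp add: g0)
  obtain m where m: "0 < m" "\<And>s. \<delta>0 \<le> s \<Longrightarrow> s \<le> S \<Longrightarrow> m \<le> g s"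
  proof (cases "\<delta>0 \<le> S")
    case True
    have "continuous_on {\<delta>0..S} g"
      using cont by (rule continuous_on_subset) (use d(1) in \<open>auto simp: \<delta>0_def\<close>)
    then obtain x where "x \<in> {\<delta>0..S}" "\<And>t. t \<in> {\<delta>0..S} \<Longrightarrow> g x \<le> g t"
      using continuous_attains_inf[of "{\<delta>0..S}" g] True by auto
    with that[of "g x"] pos[of x] d(1) show ?thesis
      by (auto simp: \<delta>0_def)
  qed (use that[of 1] in auto)
  define \<delta> where "\<delta> = min \<delta>0 (m / p')"
  have "0 < \<delta>"
    using d(1) m(1) p' by (simp add: \<delta>_def \<delta>0_def)
  moreover have "p' * min s \<delta> \<le> g s" if "s \<in> {0..S}" for s
  proof (cases "s \<le> \<delta>0")
    case True
    have "p' * min s \<delta> \<le> p' * s"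
      using p' by (intro mult_left_mono) auto
    then show ?thesis
      using near[of s] True that by simp
  next
    case False
    have "p' * min s \<delta> \<le> p' * (m / p')"
      using p' by (intro mult_left_mono) (auto simp: \<delta>_def)
    then show ?thesis
      using m(2)[of s] False that p' by simp
  qed
  ultimately show ?thesis
    by blast
qed

text \<open>The quotient \<open>g s / min s z\<close> exceeds 1 on \<open>(0, S]\<close>.
  Compactness makes this uniform away from 0, and \<open>p > 1\<close> makes it uniform near
  0.\<close>

lemma lower_bound_superlinear:
  fixes g :: "real \<Rightarrow> real"
  assumes cont: "continuous_on {0..} g" and g0: "g 0 = 0" and pos: "\<And>s. 0 < s \<Longrightarrow> 0 < g s"
    and deriv: "(g has_real_derivative p) (at 0 within {0..})" "1 < p"
    and z: "0 < z" and above: "\<And>s. 0 < s \<Longrightarrow> s \<le> z \<Longrightarrow> s < g s"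
    and beyond: "\<And>s. z \<le> s \<Longrightarrow> s \<le> S \<Longrightarrow> z < g s"
  shows "\<exists>\<gamma>>1. \<forall>s\<in>{0..S}. \<gamma> * min s z \<le> g s"
proof -
  define p' where "p' = (1 + p) / 2"
  have p': "1 < p'" "p' < p"
    using deriv(2) by (auto simp: p'_def)
  obtain \<delta> where \<delta>: "0 < \<delta>" "\<forall>s\<in>{0..S}. p' * min s \<delta> \<le> g s"
    using lower_bound_from_derivative[OF cont g0 pos deriv(1), of p' S] p' by auto
  define a where "a = min \<delta> z"
  have a: "0 < a" "a \<le> \<delta>" "a \<le> z"
    using \<delta>(1) z by (auto simp: a_def)
  obtain r where r: "1 < r" "\<And>s. a \<le> s \<Longrightarrow> s \<le> S \<Longrightarrow> r * min s z \<le> g s"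
  proof (cases "a \<le> S")
    case True
    have "continuous_on {a..S} (\<lambda>s. g s / min s z)"
      using a z by (intro continuous_intros continuous_on_subset[OF cont]) (auto simp: min_def)
    then obtain x where x: "x \<in> {a..S}" "\<And>t. t \<in> {a..S} \<Longrightarrow> g x / min x z \<le> g t / min t z"
      using continuous_attains_inf[of "{a..S}" "\<lambda>s. g s / min s z"] True by auto
    have "min x z < g x"
      using above[of x] beyond[of x] x(1) a by (cases "x \<le> z") auto
    then have "1 < g x / min x z"
      using x(1) a z by simp
    moreover have "g x / min x z * min s z \<le> g s" if "a \<le> s" "s \<le> S" for s
    proof -
      have "g x / min x z \<le> g s / min s z"
        using that by (intro x(2)) auto
      moreover have "0 < min s z"
        using that a z by simp
      ultimately show ?thesis
        by (simp only: pos_le_divide_eq)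
    qed
    ultimately show ?thesis
      using that by blast
  qed (use that[of 2] in auto)
  have "min p' r * min s z \<le> g s" if "s \<in> {0..S}" for s
  proof (cases "a \<le> s")
    case True
    have "min p' r * min s z \<le> r * min s z"
      using that z by (intro mult_right_mono) auto
    then show ?thesis
      using r(2)[of s] True that by simp
  next
    case False
    have "min p' r * min s z \<le> p' * min s z"
      using that z by (intro mult_right_mono) auto
    \<comment> \<open>Below \<open>a\<close> both caps are inactive, so both sides equal
      \<open>s\<close>.\<close>
    moreover have "min s z = min s \<delta>"
      using False a by simp
    ultimately show ?thesis
      using bspec[OF \<delta>(2) that] by simp
  qed
  then show ?thesis
    using p' r(1) by (intro exI[of _ "min p' r"]) auto
qed

section \<open>Bounded positive wave profiles\<close>

lemma tendsto_exp_neg_at_top: "0 < \<nu> \<Longrightarrow> ((\<lambda>t. exp (- \<nu> * t)) \<longlongrightarrow> (0::real)) at_top"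
  by (rule filterlim_compose[OF exp_at_bot], rule filterlim_tendsto_neg_mult_at_bot[OF tendsto_const _ filterlim_ident]) simp

text \<open>Here \<open>K\<close> stands for the kernel already translated by \<open>c * h\<close>,
  so the equation shows no delay. The constant \<open>S\<close> may be any upper bound of the
  profile and is later its supremum.\<close>

locale wave_profile = exp_kernel +
  fixes g \<phi> \<phi>' \<phi>'' :: "real \<Rightarrow> real" and c S :: real
  assumes c_pos: "0 < c"
    and g_cont: "continuous_on {0..} g"
    and g_nonneg: "\<And>s. 0 \<le> s \<Longrightarrow> 0 \<le> g s"
    and deriv1: "\<And>s. (\<phi> has_real_derivative \<phi>' s) (at s)"
    and deriv2: "\<And>s. (\<phi>' has_real_derivative \<phi>'' s) (at s)"
    and profile_eq: "\<And>s. \<phi>'' s - c * \<phi>' s - \<phi> s + (LINT r|lebesgue. K r * g (\<phi> (s - r))) = 0"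
    and \<phi>_pos: "\<And>s. 0 < \<phi> s"
    and \<phi>_le: "\<And>s. \<phi> s \<le> S"
begin

lemma S_nonneg: "0 \<le> S"
  using \<phi>_pos[of 0] \<phi>_le[of 0] by simp

lemma continuous_profile: "continuous_on A \<phi>"
  using deriv1 by (intro DERIV_continuous_on[of _ \<phi> \<phi>']) (auto intro: has_field_derivative_at_within)

lemma g_profile_measurable [measurable]: "(\<lambda>r. g (\<phi> (s - r))) \<in> borel_measurable lebesgue"
proof -
  have "continuous_on UNIV (\<lambda>r. \<phi> (s - r))"
    by (rule continuous_on_compose2[OF continuous_profile[of UNIV]]) (auto intro: continuous_intros)
  then have "continuous_on UNIV (\<lambda>r. g (\<phi> (s - r)))"
    by (rule continuous_on_compose2[OF g_cont]) (auto intro: less_imp_le \<phi>_pos)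
  then show ?thesis
    by (intro measurable_completion) (simp add: borel_measurable_continuous_onI)
qed

lemma g_bounded: "\<exists>C. \<forall>s\<in>{0..S}. g s \<le> C"
proof -
  have "continuous_on {0..S} g"
    using g_cont by (rule continuous_on_subset) auto
  then obtain x where "\<forall>s\<in>{0..S}. g s \<le> g x"
    using continuous_attains_sup[of "{0..S}" g] S_nonneg by auto
  then show ?thesis by blast
qed

lemma profile_mem: "\<phi> s \<in> {0..S}"
  using \<phi>_pos[of s] \<phi>_le[of s] by simp

lemma integrable_profile: "integrable lebesgue (\<lambda>r. K r * g (\<phi> (s - r)))"
proof -
  obtain C where C: "\<forall>s\<in>{0..S}. g s \<le> C"
    using g_bounded by blast
  have "\<bar>g (\<phi> (s - r))\<bar> \<le> C" for r
    using C profile_mem[of "s - r"] g_nonneg[of "\<phi> (s - r)"] by simp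
  then show ?thesis
    by (intro integrable_times_bounded g_profile_measurable)
qed

lemma integral_ge:
  assumes "f \<in> borel_measurable lebesgue" "\<And>r. \<bar>f r\<bar> \<le> C" "\<And>r. f r \<le> g (\<phi> (s - r))"
  shows "(LINT r|lebesgue. K r * f r) \<le> (LINT r|lebesgue. K r * g (\<phi> (s - r)))"
  by (intro integral_mono integrable_times_bounded[OF assms(1,2)] integrable_profile mult_left_mono assms nonneg)

lemma decay_rate: "\<exists>\<nu>>0. \<nu>\<^sup>2 + c * \<nu> \<le> 1"
proof (intro exI conjI)
  show "0 < 1 / (1 + c)"
    using c_pos by simp
  have "(1 / (1 + c))\<^sup>2 \<le> 1 / (1 + c)"
    using c_pos mult_left_mono[of "1 / (1 + c)" 1 "1 / (1 + c)"] by (simp add: power2_eq_square)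
  moreover have "1 / (1 + c) + c * (1 / (1 + c)) = 1"
    using c_pos by (simp add: field_simps)
  ultimately show "(1 / (1 + c))\<^sup>2 + c * (1 / (1 + c)) \<le> 1"
    by linarith
qed

text \<open>The source is at most \<open>B\<close>, so \<open>\<phi> - B\<close> is a subsolution
  everywhere. The maximum principle on \<open>[A, \<infinity>)\<close> leaves an error
  \<open>S * exp (- \<nu> * (s - A))\<close>, which vanishes as \<open>A\<close> tends to
  -\<infinity>.\<close>

lemma profile_upper_bound:
  assumes B: "\<And>s. 0 \<le> s \<Longrightarrow> s \<le> S \<Longrightarrow> g s \<le> B"
  shows "\<phi> s \<le> B"
proof -
  have B0: "0 \<le> B"
    using B[of 0] g_nonneg[of 0] S_nonneg by simp
  obtain \<nu> where \<nu>: "0 < \<nu>" "\<nu>\<^sup>2 + c * \<nu> \<le> 1"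
    using decay_rate by blast
  have le: "\<phi> s - B \<le> S * exp (- \<nu> * (s - A))" if "A \<le> s" for A
  proof (rule max_principle_half_line[where f = "\<lambda>s. \<phi> s - B" and f' = \<phi>' and f'' = \<phi>'' and c = c])
    show "((\<lambda>s. \<phi> s - B) has_real_derivative \<phi>' t) (at t)" for t
      by (auto intro!: derivative_eq_intros deriv1)
    show "0 \<le> \<phi>'' t - c * \<phi>' t - (\<phi> t - B)" for t
    proof -
      have "(LINT r|lebesgue. K r * g (\<phi> (t - r))) \<le> (LINT r|lebesgue. K r * B)"
        using integrable_times_bounded[of "\<lambda>_. B" "\<bar>B\<bar>"] profile_mem
        by (intro integral_mono integrable_profile mult_left_mono nonneg B) auto
      also have "\<dots> = B"
        using mass by simp
      finally show ?thesis
        using profile_eq[of t] by simp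
    qed
    show "\<phi> t - B \<le> S" for t
      using \<phi>_le[of t] B0 by simp
  qed (use c_pos \<nu> deriv2 S_nonneg that in auto)
  have "((\<lambda>t. S * exp (- \<nu> * t)) \<longlongrightarrow> S * 0) at_top"
    using \<nu>(1) by (intro tendsto_mult tendsto_const tendsto_exp_neg_at_top)
  moreover have "eventually (\<lambda>t. \<phi> s - B \<le> S * exp (- \<nu> * t)) at_top"
    using eventually_ge_at_top[of 0] by eventually_elim (use le[of "s - t" for t] in auto)
  ultimately have "\<phi> s - B \<le> S * 0"
    by (intro tendsto_lowerbound) auto
  then show ?thesis
    by simp
qed

text \<open>A one-sided cut is enough: \<open>r \<le> R\<close> and \<open>s \<ge> A + R\<close>
  imply \<open>s - r \<ge> A\<close>, so negative \<open>r\<close> only move further into the region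
  where a lower bound is known.\<close>

lemma truncated_mass:
  assumes "\<eta> < 1"
  shows "\<exists>R. \<eta> < (LINT r|lebesgue. K r * indicator {..R} r)"
proof -
  have "(\<lambda>n. LINT r|lebesgue. K r * indicator {..real n} r) \<longlonglongrightarrow> (LINT r|lebesgue. K r)"
  proof (rule integral_dominated_convergence[where w = K])
    show "AE r in lebesgue. (\<lambda>n. K r * indicator {..real n} r) \<longlonglongrightarrow> K r"
    proof (intro AE_I2 tendsto_eventually)
      fix r
      obtain N where "r \<le> real N"
        using real_arch_simple by blast
      then have "\<forall>n\<ge>N. K r * indicator {..real n} r = K r"
        by (auto simp: indicator_def) 
      then show "eventually (\<lambda>n. K r * indicator {..real n} r = K r) sequentially"
        using eventually_sequentially by blast
    qed
    show "AE r in lebesgue. norm (K r * indicator {..real n} r) \<le> K r" for n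
      using nonneg by (auto simp: indicator_def)
    show "(\<lambda>r. K r * indicator {..real n} r) \<in> borel_measurable lebesgue" for n
      by (intro borel_measurable_times measurable_kernel borel_measurable_indicator) auto
  qed (auto intro: integrable_kernel)
  then have "eventually (\<lambda>n. \<eta> < (LINT r|lebesgue. K r * indicator {..real n} r)) sequentially"
    using assms mass by (intro order_tendstoD(1)) auto
  then show ?thesis
    by (auto simp: eventually_sequentially)
qed

text \<open>
  A lower bound \<open>m\<close> near \<open>+\<infinity>\<close> makes the nonlocal term nearly \<open>\<gamma> m\<close> there, which the
  maximum principle hands back to the profile.
\<close>

lemma improve_lower_bound:
  assumes \<gamma>: "0 < \<gamma>" "\<forall>s\<in>{0..S}. \<gamma> * min s z \<le> g s"
    and m: "0 < m" "m \<le> z" "\<And>s. A \<le> s \<Longrightarrow> m \<le> \<phi> s"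
    and \<theta>: "\<theta> < \<gamma> * m"
  shows "\<exists>A'. \<forall>s\<ge>A'. \<theta> \<le> \<phi> s"
proof -
  \<comment> \<open>A level strictly between: the gap to \<open>\<gamma> * m\<close> pays for the
    lost tail of the kernel, the gap to \<open>\<theta>\<close> for the exponential
    transient.\<close>
  define \<theta>' where "\<theta>' = (max 0 \<theta> + \<gamma> * m) / 2"
  have \<theta>': "0 < \<theta>'" "\<theta> < \<theta>'" "\<theta>' < \<gamma> * m"
    using \<theta> \<gamma>(1) m(1) mult_pos_pos[OF \<gamma>(1) m(1)] by (auto simp: \<theta>'_def max_def)
  then have "\<theta>' / (\<gamma> * m) < 1"
    using \<gamma>(1) m(1) by simp
  then obtain R where R: "\<theta>' / (\<gamma> * m) < (LINT r|lebesgue. K r * indicator {..R} r)"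
    using truncated_mass by blast
  have source: "\<theta>' \<le> (LINT r|lebesgue. K r * g (\<phi> (s - r)))" if "A + R \<le> s" for s
  proof -
    have "\<theta>' \<le> (LINT r|lebesgue. K r * indicator {..R} r) * (\<gamma> * m)"
      using R \<gamma>(1) m(1) by (simp add: field_simps)
    also have "\<dots> = (LINT r|lebesgue. K r * (indicator {..R} r * (\<gamma> * m)))"
      by (simp add: mult.assoc[symmetric])
    also have "\<dots> \<le> (LINT r|lebesgue. K r * g (\<phi> (s - r)))"
    proof (rule integral_ge[of _ "\<gamma> * m"])
      show "(\<lambda>r. indicator {..R} r * (\<gamma> * m)) \<in> borel_measurable lebesgue"
        by (intro borel_measurable_times borel_measurable_indicator borel_measurable_const) auto
      show "\<bar>indicator {..R} r * (\<gamma> * m)\<bar> \<le> \<gamma> * m" for r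
        using \<gamma>(1) m(1) by (auto simp: indicator_def)
      show "indicator {..R} r * (\<gamma> * m) \<le> g (\<phi> (s - r))" for r
      proof (cases "r \<le> R")
        case True
        then have "m \<le> min (\<phi> (s - r)) z"
          using m(2) m(3)[of "s - r"] that by simp
        then have "\<gamma> * m \<le> \<gamma> * min (\<phi> (s - r)) z"
          using \<gamma>(1) by (intro mult_left_mono) auto
        also have "\<dots> \<le> g (\<phi> (s - r))"
          using \<gamma>(2) profile_mem by blast
        finally show ?thesis
          using True by simp
      next
        case False
        then show ?thesis
          using g_nonneg[of "\<phi> (s - r)"] \<phi>_pos[of "s - r"] by simp
      qed
    qed
    finally show ?thesis .
  qed
  obtain \<nu> where \<nu>: "0 < \<nu>" "\<nu>\<^sup>2 + c * \<nu> \<le> 1"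
    using decay_rate by blast
  have le: "\<theta>' - \<phi> s \<le> \<theta>' * exp (- \<nu> * (s - (A + R)))" if "A + R \<le> s" for s
  proof (rule max_principle_half_line[where f = "\<lambda>s. \<theta>' - \<phi> s" and f' = "\<lambda>s. - \<phi>' s"
        and f'' = "\<lambda>s. - \<phi>'' s" and c = c])
    show "((\<lambda>s. \<theta>' - \<phi> s) has_real_derivative - \<phi>' t) (at t)" for t
      by (auto intro!: derivative_eq_intros deriv1)
    show "((\<lambda>s. - \<phi>' s) has_real_derivative - \<phi>'' t) (at t)" for t
      by (auto intro!: derivative_eq_intros deriv2)
    show "0 \<le> - \<phi>'' t - c * - \<phi>' t - (\<theta>' - \<phi> t)" if "A + R < t" for t
      using profile_eq[of t] source[of t] that by simp
    show "\<theta>' - \<phi> t \<le> \<theta>'" for t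
      using \<phi>_pos[of t] by simp
  qed (use c_pos \<nu> \<theta>' that in auto)
  have "filterlim (\<lambda>t. t - (A + R)) at_top at_top"
    using filterlim_tendsto_add_at_top[OF tendsto_const filterlim_ident, of "- (A + R)"]
    by (rule filterlim_cong[THEN iffD1, rotated -1]) auto
  then have "((\<lambda>t. \<theta>' * exp (- \<nu> * (t - (A + R)))) \<longlongrightarrow> \<theta>' * 0) at_top"
    using \<nu>(1) by (intro tendsto_mult tendsto_const filterlim_compose[OF tendsto_exp_neg_at_top]) (simp_all add: add.commute)
  then have "eventually (\<lambda>t. \<theta>' * exp (- \<nu> * (t - (A + R))) < \<theta>' - \<theta>) at_top"
    using \<theta>' by (intro order_tendstoD(2)) auto
  then have "eventually (\<lambda>t. \<theta> \<le> \<phi> t) at_top"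
    using eventually_ge_at_top[of "A + R"] by eventually_elim (use le in fastforce)
  then show ?thesis
    by (simp add: eventually_at_top_linorder)
qed

text \<open>A supremum argument replaces iteration. If the supremum \<open>M\<close> of the eventual
  lower bounds were below \<open>z\<close>, a bound \<open>m > M / \<gamma>\<close> could be
  improved to a level above \<open>M\<close> and still below \<open>z\<close>.\<close>

lemma eventually_above:
  assumes \<gamma>: "1 < \<gamma>" "\<forall>s\<in>{0..S}. \<gamma> * min s z \<le> g s"
    and \<epsilon>: "0 < \<epsilon>" "\<epsilon> \<le> z" "\<And>s. A \<le> s \<Longrightarrow> \<epsilon> \<le> \<phi> s"
    and \<zeta>: "\<zeta> < z"
  shows "eventually (\<lambda>s. \<zeta> \<le> \<phi> s) at_top"
proof -
  define T where "T = {m. m \<le> z \<and> (\<exists>A. \<forall>s\<ge>A. m \<le> \<phi> s)}"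
  define M where "M = Sup T"
  have \<epsilon>T: "\<epsilon> \<in> T"
    unfolding T_def using \<epsilon> by blast
  have bdd: "bdd_above T"
    unfolding T_def by (intro bdd_aboveI[of _ z]) auto
  have "\<epsilon> \<le> M"
    unfolding M_def by (rule cSup_upper[OF \<epsilon>T bdd])
  have "z \<le> M"
  proof (rule ccontr)
    assume "\<not> z \<le> M"
    have "M / \<gamma> < M"
      using \<gamma>(1) \<epsilon>(1) \<open>\<epsilon> \<le> M\<close> by (simp add: field_simps)
    then obtain m where m: "m \<in> T" "M / \<gamma> < m"
      using less_cSup_iff[OF _ bdd] \<epsilon>T unfolding M_def by blast
    have "0 < M / \<gamma>"
      using \<gamma>(1) \<epsilon>(1) \<open>\<epsilon> \<le> M\<close> by simp
    then have "0 < m"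
      using m(2) by simp
    have "M < \<gamma> * m"
      using m(2) \<gamma>(1) by (simp add: field_simps)
    then obtain \<theta> where \<theta>: "M < \<theta>" "\<theta> < min (\<gamma> * m) z"
      using dense[of M "min (\<gamma> * m) z"] \<open>\<not> z \<le> M\<close> by auto
    obtain A' where "m \<le> z" "\<And>s. A' \<le> s \<Longrightarrow> m \<le> \<phi> s"
      using m(1) unfolding T_def by blast
    then have "\<exists>A. \<forall>s\<ge>A. \<theta> \<le> \<phi> s"
      using improve_lower_bound[of \<gamma> z m A' \<theta>] \<gamma> \<open>0 < m\<close> \<theta> by simp
    then have "\<theta> \<in> T"
      unfolding T_def using \<theta> by simp
    then have "\<theta> \<le> M"
      unfolding M_def by (rule cSup_upper[OF _ bdd])
    with \<theta>(1) show False
      by simp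
  qed
  then have "\<zeta> < Sup T"
    using \<zeta> unfolding M_def by simp
  then obtain m where "m \<in> T" "\<zeta> < m"
    using less_cSup_iff[OF _ bdd] \<epsilon>T by blast
  then show ?thesis
    unfolding T_def eventually_at_top_linorder by fastforce
qed

end

section \<open>A compactly supported subsolution\<close>

lemma exp_times_abs_le: "\<bar>r\<bar> * exp (\<mu> * r) \<le> exp ((\<bar>\<mu>\<bar> + 1) * \<bar>r\<bar>)" for r :: real
proof -
  have "\<bar>r\<bar> \<le> exp \<bar>r\<bar>"
    using exp_ge_add_one_self[of "\<bar>r\<bar>"] by linarith
  moreover have "\<mu> * r \<le> \<bar>\<mu>\<bar> * \<bar>r\<bar>"
    by (metis abs_ge_self abs_mult)
  ultimately have "\<bar>r\<bar> * exp (\<mu> * r) \<le> exp \<bar>r\<bar> * exp (\<bar>\<mu>\<bar> * \<bar>r\<bar>)"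
    by (intro mult_mono) auto
  then show ?thesis
    by (simp add: exp_add[symmetric] algebra_simps)
qed

lemma window_tendsto:
  fixes f :: "nat \<Rightarrow> real \<Rightarrow> real"
  assumes "(\<lambda>n. f n r) \<longlonglongrightarrow> l"
  shows "(\<lambda>n. indicator {- (pi / inverse (real (Suc n)))..pi / inverse (real (Suc n))} r * f n r) \<longlonglongrightarrow> l"
proof (rule Lim_transform_eventually[OF assms])
  obtain N where N: "\<bar>r\<bar> / pi \<le> real N"
    using real_arch_simple by blast
  have "f n r = indicator {- (pi / inverse (real (Suc n)))..pi / inverse (real (Suc n))} r * f n r"
    if "N \<le> n" for n
  proof -
    have "\<bar>r\<bar> / pi \<le> real (Suc n)"
      using N that by linarith
    then have "\<bar>r\<bar> \<le> pi * real (Suc n)"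
      by (simp add: pos_divide_le_eq mult.commute)
    then have "r \<in> {- (pi / inverse (real (Suc n)))..pi / inverse (real (Suc n))}"
      by (auto simp: divide_inverse abs_le_iff simp del: of_nat_Suc)
    then show ?thesis
      by simp
  qed
  then show "eventually (\<lambda>n. f n r = indicator {- (pi / inverse (real (Suc n)))..pi / inverse (real (Suc n))} r * f n r) sequentially"
    by (auto simp: eventually_sequentially)
qed

lemma indicator_measurable_lebesgue [measurable]: "(\<lambda>r. indicator {a..b::real} r :: real) \<in> borel_measurable lebesgue"
  by (intro borel_measurable_indicator) auto

lemma sin_cos_measurable_lebesgue [measurable]:
  "(\<lambda>r::real. sin (\<beta> * r)) \<in> borel_measurable lebesgue"
  "(\<lambda>r::real. cos (\<beta> * r)) \<in> borel_measurable lebesgue"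
  by (simp_all add: measurable_completion)

context exp_kernel
begin

lemma integrable_first_moment: "integrable lebesgue (\<lambda>r. K r * (r * exp (\<mu> * r)))"
  by (rule integrable_times[of _ 1 "\<bar>\<mu>\<bar> + 1"]) (use exp_times_abs_le in \<open>simp_all add: abs_mult\<close>)

text \<open>This is the monotonicity of the derivative of the convex function giving the exponential
  moment, and it already holds under the integral for either sign of \<open>r\<close>.\<close>

lemma first_moment_mono:
  assumes "\<mu> \<le> \<mu>'"
  shows "(LINT r|lebesgue. K r * (r * exp (\<mu> * r))) \<le> (LINT r|lebesgue. K r * (r * exp (\<mu>' * r)))"
proof (intro integral_mono integrable_first_moment)
  fix r
  have "r * exp (\<mu> * r) \<le> r * exp (\<mu>' * r)"
  proof (cases "0 \<le> r")
    case True
    then show ?thesis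
      using assms by (intro mult_left_mono) (auto intro: mult_right_mono)
  next
    case False
    then show ?thesis
      using assms by (intro mult_left_mono_neg) (auto intro: mult_right_mono_neg)
  qed
  then show "K r * (r * exp (\<mu> * r)) \<le> K r * (r * exp (\<mu>' * r))"
    using nonneg by (rule mult_left_mono)
qed

lemma continuous_first_moment: "continuous_on UNIV (\<lambda>\<mu>. LINT r|lebesgue. K r * (r * exp (\<mu> * r)))"
proof (rule continuous_on_sequentiallyI)
  fix u :: "nat \<Rightarrow> real" and a
  assume u: "u \<longlonglongrightarrow> a"
  then obtain B where B: "\<And>n. \<bar>u n\<bar> \<le> B"
    using convergent_imp_Bseq[of u] by (auto simp: convergent_def Bseq_def)
  show "(\<lambda>n. LINT r|lebesgue. K r * (r * exp (u n * r))) \<longlonglongrightarrow> (LINT r|lebesgue. K r * (r * exp (a * r)))"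
  proof (rule integral_dominated_convergence[where w = "\<lambda>r. K r * exp ((B + 1) * \<bar>r\<bar>)"])
    show "AE r in lebesgue. (\<lambda>n. K r * (r * exp (u n * r))) \<longlonglongrightarrow> K r * (r * exp (a * r))"
      by (intro AE_I2 tendsto_intros u)
    show "AE r in lebesgue. norm (K r * (r * exp (u n * r))) \<le> K r * exp ((B + 1) * \<bar>r\<bar>)" for n
    proof (intro AE_I2)
      fix r
      have "(\<bar>u n\<bar> + 1) * \<bar>r\<bar> \<le> (B + 1) * \<bar>r\<bar>"
        using B[of n] by (intro mult_right_mono) auto
      then have "\<bar>r\<bar> * exp (u n * r) \<le> exp ((B + 1) * \<bar>r\<bar>)"
        using exp_times_abs_le[of r "u n"] by (meson exp_le_cancel_iff order.trans)
      then show "norm (K r * (r * exp (u n * r))) \<le> K r * exp ((B + 1) * \<bar>r\<bar>)"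
        using nonneg[of r] by (simp add: abs_mult mult_left_mono)
    qed
  qed (auto intro: integrable_exp_abs)
qed

text \<open>
  The two inequalities say that the tangent at \<open>- \<mu>\<close> to the characteristic function
  \<open>l \<mapsto> l\<^sup>2 - c l - 1 + p \<integral> K r exp (- l r) dr\<close> is decreasing and positive at \<open>l = 0\<close>.
  If the minimum lies to the right of \<open>0\<close> one takes \<open>\<mu> = 0\<close>, otherwise \<open>- \<mu>\<close> slightly to the left of it.
\<close>

lemma ex_tangent_exponent:
  fixes c p :: real
  defines "F \<equiv> \<lambda>\<mu>. \<mu>\<^sup>2 + c * \<mu> - 1 + p * (LINT r|lebesgue. K r * exp (\<mu> * r))"
    and "D \<equiv> \<lambda>\<mu>. 2 * \<mu> + c + p * (LINT r|lebesgue. K r * (r * exp (\<mu> * r)))"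
  assumes p: "0 < p" and F_pos: "\<And>\<mu>. 0 \<le> \<mu> \<Longrightarrow> 0 < F \<mu>"
  shows "\<exists>\<mu>\<ge>0. 0 < D \<mu> \<and> \<mu> * D \<mu> < F \<mu>"
proof (cases "0 < D 0")
  case True
  then show ?thesis
    using F_pos[of 0] by (intro exI[of _ 0]) simp
next
  case False
  have D_mono: "D \<mu> + 2 * (\<mu>' - \<mu>) \<le> D \<mu>'" if "\<mu> \<le> \<mu>'" for \<mu> \<mu>'
    using mult_left_mono[OF first_moment_mono[OF that], of p] p unfolding D_def by simp
  have D_cont: "continuous_on A D" for A
    unfolding D_def by (intro continuous_intros continuous_on_subset[OF continuous_first_moment]) auto
  have "continuous_on UNIV (\<lambda>\<mu>. LINT r|lebesgue. K r * exp (\<mu> * r))"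
    using continuous_exp_affine[of 0 1] by simp
  then have F_cont: "continuous_on UNIV F"
    unfolding F_def by (intro continuous_intros)
  \<comment> \<open>\<open>D\<close> grows at least at rate 2, so it is nonnegative at
    \<open>u\<close> at the latest.\<close>
  define u where "u = \<bar>D 0\<bar> + 1"
  have "0 \<le> D u"
    using D_mono[of 0 u] by (simp add: u_def)
  then obtain m where m: "0 \<le> m" "m \<le> u" "D m = 0"
    using IVT'[of D 0 0 u] False D_cont by (auto simp: u_def)
  \<comment> \<open>At \<open>m\<close> the slope vanishes and \<open>F m > 0\<close>. Slightly to
    the right the slope is positive, while \<open>F \<mu> - \<mu> * D \<mu> > 0\<close> persists by
    continuity.\<close>
  have "continuous_on UNIV (\<lambda>\<mu>. F \<mu> - \<mu> * D \<mu>)"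
    by (intro continuous_intros F_cont D_cont)
  then have "((\<lambda>\<mu>. F \<mu> - \<mu> * D \<mu>) \<longlongrightarrow> F m - m * D m) (at_right m)"
    by (auto simp: continuous_on_def intro: tendsto_within_subset)
  then have "eventually (\<lambda>\<mu>. 0 < F \<mu> - \<mu> * D \<mu>) (at_right m)"
    using F_pos[of m] m by (intro order_tendstoD(1)) auto
  then obtain b where b: "m < b" "\<And>\<mu>. m < \<mu> \<Longrightarrow> \<mu> < b \<Longrightarrow> 0 < F \<mu> - \<mu> * D \<mu>"
    unfolding eventually_at_right_field by blast
  define \<mu> where "\<mu> = (m + b) / 2"
  have "0 < F \<mu> - \<mu> * D \<mu>" "0 < D \<mu>" "0 \<le> \<mu>"
    using b(1) m D_mono[of m \<mu>] b(2)[of \<mu>] by (auto simp: \<mu>_def)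
  then show ?thesis
    by auto
qed

text \<open>Real part of the moment with exponent \<open>\<mu> + i \<beta>\<close>, cut to half a
  period on either side of 0. On this window the cosine bump cannot reach its next positive
  arch.\<close>

definition cos_moment :: "real \<Rightarrow> real \<Rightarrow> real" where
  "cos_moment \<mu> \<beta> = (LINT r|lebesgue. K r * (indicator {- (pi / \<beta>)..pi / \<beta>} r * (exp (\<mu> * r) * cos (\<beta> * r))))"

text \<open>The corresponding imaginary part, divided by \<open>\<beta>\<close> so that it converges
  to the first moment as \<open>\<beta>\<close> tends to 0.\<close>

definition sin_moment :: "real \<Rightarrow> real \<Rightarrow> real" where
  "sin_moment \<mu> \<beta> = (LINT r|lebesgue. K r * (indicator {- (pi / \<beta>)..pi / \<beta>} r * (exp (\<mu> * r) * (sin (\<beta> * r) / \<beta>))))"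

lemma tendsto_cos_moment:
  "(\<lambda>n. cos_moment \<mu> (inverse (real (Suc n)))) \<longlonglongrightarrow> (LINT r|lebesgue. K r * exp (\<mu> * r))"
  unfolding cos_moment_def
proof (rule integral_dominated_convergence[where w = "\<lambda>r. K r * exp (\<mu> * r)"])
  have "(\<lambda>n. cos (inverse (real (Suc n)) * r)) \<longlonglongrightarrow> cos (0 * r)" for r :: real
    by (intro tendsto_intros LIMSEQ_inverse_real_of_nat)
  then have "(\<lambda>n. exp (\<mu> * r) * cos (inverse (real (Suc n)) * r)) \<longlonglongrightarrow> exp (\<mu> * r) * cos (0 * r)" for r :: real
    by (rule tendsto_mult[OF tendsto_const])
  then have "(\<lambda>n. exp (\<mu> * r) * cos (inverse (real (Suc n)) * r)) \<longlonglongrightarrow> exp (\<mu> * r)" for r :: real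
    by simp
  then show "AE r in lebesgue. (\<lambda>n. K r * (indicator {- (pi / inverse (real (Suc n)))..pi / inverse (real (Suc n))} r
      * (exp (\<mu> * r) * cos (inverse (real (Suc n)) * r)))) \<longlonglongrightarrow> K r * exp (\<mu> * r)"
    by (intro AE_I2 tendsto_mult tendsto_const window_tendsto)
  show "AE r in lebesgue. norm (K r * (indicator {- (pi / inverse (real (Suc n)))..pi / inverse (real (Suc n))} r
      * (exp (\<mu> * r) * cos (inverse (real (Suc n)) * r)))) \<le> K r * exp (\<mu> * r)" for n
  proof (intro AE_I2)
    fix r
    have "\<bar>exp (\<mu> * r) * cos (inverse (real (Suc n)) * r)\<bar> \<le> exp (\<mu> * r) * 1"
      unfolding abs_mult by (intro mult_mono) auto
    then show "norm (K r * (indicator {- (pi / inverse (real (Suc n)))..pi / inverse (real (Suc n))} r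
      * (exp (\<mu> * r) * cos (inverse (real (Suc n)) * r)))) \<le> K r * exp (\<mu> * r)"
      using nonneg[of r] by (auto simp: abs_mult mult_left_mono indicator_def simp del: of_nat_Suc)
  qed
qed (use exp_moments in measurable)

lemma tendsto_sin_moment:
  "(\<lambda>n. sin_moment \<mu> (inverse (real (Suc n)))) \<longlonglongrightarrow> (LINT r|lebesgue. K r * (r * exp (\<mu> * r)))"
  unfolding sin_moment_def
proof (rule integral_dominated_convergence[where w = "\<lambda>r. K r * exp ((\<bar>\<mu>\<bar> + 1) * \<bar>r\<bar>)"])
  have "(\<lambda>n. exp (\<mu> * r) * (sin (inverse (real (Suc n)) * r) / inverse (real (Suc n)))) \<longlonglongrightarrow> r * exp (\<mu> * r)" for r :: real
  proof -
    have "((\<lambda>x. sin (x * r)) has_real_derivative r) (at 0)"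
      by (auto intro!: derivative_eq_intros)
    then have "((\<lambda>x. sin (x * r) / x) \<longlongrightarrow> r) (at 0)"
      by (simp add: has_field_derivative_iff)
    moreover have "filterlim (\<lambda>n. inverse (real (Suc n))) (at 0) sequentially"
      using LIMSEQ_inverse_real_of_nat by (auto simp: filterlim_at)
    ultimately have "(\<lambda>n. sin (inverse (real (Suc n)) * r) / inverse (real (Suc n))) \<longlonglongrightarrow> r"
      by (rule filterlim_compose)
    then have "(\<lambda>n. exp (\<mu> * r) * (sin (inverse (real (Suc n)) * r) / inverse (real (Suc n)))) \<longlonglongrightarrow> exp (\<mu> * r) * r"
      by (intro tendsto_mult tendsto_const)
    then show ?thesis
      by (simp add: mult.commute)
  qed
  then show "AE r in lebesgue. (\<lambda>n. K r * (indicator {- (pi / inverse (real (Suc n)))..pi / inverse (real (Suc n))} r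
      * (exp (\<mu> * r) * (sin (inverse (real (Suc n)) * r) / inverse (real (Suc n)))))) \<longlonglongrightarrow> K r * (r * exp (\<mu> * r))"
    by (intro AE_I2 tendsto_mult[OF tendsto_const] window_tendsto)
  show "AE r in lebesgue. norm (K r * (indicator {- (pi / inverse (real (Suc n)))..pi / inverse (real (Suc n))} r
      * (exp (\<mu> * r) * (sin (inverse (real (Suc n)) * r) / inverse (real (Suc n)))))) \<le> K r * exp ((\<bar>\<mu>\<bar> + 1) * \<bar>r\<bar>)" for n
  proof (intro AE_I2)
    fix r
    define \<beta> where "\<beta> = inverse (real (Suc n))"
    have "0 < \<beta>"
      by (simp add: \<beta>_def)
    have "\<bar>sin (\<beta> * r) / \<beta>\<bar> \<le> \<bar>\<beta> * r\<bar> / \<beta>"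
      using \<open>0 < \<beta>\<close> abs_sin_x_le_abs_x[of "\<beta> * r"] by (simp add: abs_divide divide_right_mono)
    also have "\<dots> = \<bar>r\<bar>"
      using \<open>0 < \<beta>\<close> by (simp add: abs_mult)
    finally have "\<bar>exp (\<mu> * r) * (sin (\<beta> * r) / \<beta>)\<bar> \<le> exp (\<mu> * r) * \<bar>r\<bar>"
      unfolding abs_mult by (intro mult_mono) auto
    also have "\<dots> \<le> exp ((\<bar>\<mu>\<bar> + 1) * \<bar>r\<bar>)"
      using exp_times_abs_le[of r \<mu>] by (simp add: mult.commute)
    finally have "\<bar>exp (\<mu> * r) * (sin (\<beta> * r) / \<beta>)\<bar> \<le> exp ((\<bar>\<mu>\<bar> + 1) * \<bar>r\<bar>)" .
    then have "\<bar>indicator {- (pi / \<beta>)..pi / \<beta>} r * (exp (\<mu> * r) * (sin (\<beta> * r) / \<beta>))\<bar> \<le> exp ((\<bar>\<mu>\<bar> + 1) * \<bar>r\<bar>)"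
      by (auto simp: indicator_def)
    then have "K r * \<bar>indicator {- (pi / \<beta>)..pi / \<beta>} r * (exp (\<mu> * r) * (sin (\<beta> * r) / \<beta>))\<bar> \<le> K r * exp ((\<bar>\<mu>\<bar> + 1) * \<bar>r\<bar>)"
      by (intro mult_left_mono nonneg)
    moreover have "norm (K r * x) = K r * \<bar>x\<bar>" for x
      using nonneg[of r] by (simp add: abs_mult)
    ultimately show "norm (K r * (indicator {- (pi / inverse (real (Suc n)))..pi / inverse (real (Suc n))} r
      * (exp (\<mu> * r) * (sin (inverse (real (Suc n)) * r) / inverse (real (Suc n)))))) \<le> K r * exp ((\<bar>\<mu>\<bar> + 1) * \<bar>r\<bar>)"
      unfolding \<beta>_def by metis
  qed
qed (use integrable_first_moment integrable_exp_abs in measurable)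

text \<open>With \<open>im_symbol\<close>: \<open>re_symbol + i \<beta> im_symbol\<close> is the
  characteristic function at \<open>- \<mu> - i \<beta>\<close>, with windowed moments and slope
  \<open>p - \<beta>\<close> in place of \<open>p\<close>.\<close>

definition re_symbol :: "real \<Rightarrow> real \<Rightarrow> real \<Rightarrow> real \<Rightarrow> real" where
  "re_symbol c p \<mu> \<beta> = \<mu>\<^sup>2 - \<beta>\<^sup>2 + c * \<mu> - 1 + (p - \<beta>) * cos_moment \<mu> \<beta>"

definition im_symbol :: "real \<Rightarrow> real \<Rightarrow> real \<Rightarrow> real \<Rightarrow> real" where
  "im_symbol c p \<mu> \<beta> = 2 * \<mu> + c + (p - \<beta>) * sin_moment \<mu> \<beta>"

text \<open>As \<open>\<beta>\<close> tends to 0 the two symbols tend to \<open>F \<mu>\<close> and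
  \<open>D \<mu>\<close> of the tangent construction, and strict inequalities survive.
  \<open>M\<close> is chosen between \<open>\<mu>\<close> and \<open>F \<mu> / D \<mu>\<close>; the
  margin \<open>M > \<mu>\<close> later becomes the positive slope of the bump at its starting
  point.\<close>

lemma ex_oscillating_exponent:
  assumes p: "0 < p"
    and F_pos: "\<And>\<mu>. 0 \<le> \<mu> \<Longrightarrow> 0 < \<mu>\<^sup>2 + c * \<mu> - 1 + p * (LINT r|lebesgue. K r * exp (\<mu> * r))"
  shows "\<exists>\<mu> M \<beta>. 0 \<le> \<mu> \<and> \<mu> < M \<and> 0 < \<beta> \<and> \<beta> < p \<and>
    0 < im_symbol c p \<mu> \<beta> \<and> M * im_symbol c p \<mu> \<beta> < re_symbol c p \<mu> \<beta>"
proof -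
  define F where "F \<mu> = \<mu>\<^sup>2 + c * \<mu> - 1 + p * (LINT r|lebesgue. K r * exp (\<mu> * r))" for \<mu>
  define D where "D \<mu> = 2 * \<mu> + c + p * (LINT r|lebesgue. K r * (r * exp (\<mu> * r)))" for \<mu>
  obtain \<mu> where \<mu>: "0 \<le> \<mu>" "0 < D \<mu>" "\<mu> * D \<mu> < F \<mu>"
    using ex_tangent_exponent[of p c] p F_pos unfolding D_def F_def by auto
  then have "\<mu> < F \<mu> / D \<mu>"
    by (simp add: pos_less_divide_eq)
  then obtain M where M: "\<mu> < M" "M < F \<mu> / D \<mu>"
    using dense by blast
  then have MD: "0 < F \<mu> - M * D \<mu>"
    using \<mu>(2) by (simp add: pos_less_divide_eq)
  define b where "b n = inverse (real (Suc n))" for n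
  have b: "b \<longlonglongrightarrow> 0"
    unfolding b_def by (rule LIMSEQ_inverse_real_of_nat)
  have re: "(\<lambda>n. re_symbol c p \<mu> (b n)) \<longlonglongrightarrow> \<mu>\<^sup>2 - 0\<^sup>2 + c * \<mu> - 1 + (p - 0) * (LINT r|lebesgue. K r * exp (\<mu> * r))"
    unfolding re_symbol_def by (intro tendsto_intros b tendsto_cos_moment[of \<mu>, folded b_def])
  have im: "(\<lambda>n. im_symbol c p \<mu> (b n)) \<longlonglongrightarrow> 2 * \<mu> + c + (p - 0) * (LINT r|lebesgue. K r * (r * exp (\<mu> * r)))"
    unfolding im_symbol_def by (intro tendsto_intros b tendsto_sin_moment[of \<mu>, folded b_def])
  have "(\<lambda>n. re_symbol c p \<mu> (b n) - M * im_symbol c p \<mu> (b n)) \<longlonglongrightarrow> F \<mu> - M * D \<mu>"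
    using tendsto_diff[OF re tendsto_mult[OF tendsto_const[of M] im]] by (simp add: F_def D_def)
  then have "eventually (\<lambda>n. 0 < re_symbol c p \<mu> (b n) - M * im_symbol c p \<mu> (b n)) sequentially"
    using MD by (rule order_tendstoD(1))
  moreover have "eventually (\<lambda>n. 0 < im_symbol c p \<mu> (b n)) sequentially"
    using im \<mu>(2) by (intro order_tendstoD(1)) (auto simp: D_def)
  moreover have "eventually (\<lambda>n. b n < p) sequentially"
    using b p by (rule order_tendstoD(2))
  ultimately have "eventually (\<lambda>n. 0 < re_symbol c p \<mu> (b n) - M * im_symbol c p \<mu> (b n) \<and>
      0 < im_symbol c p \<mu> (b n) \<and> b n < p) sequentially"
    by eventually_elim auto
  then obtain n where n: "0 < re_symbol c p \<mu> (b n) - M * im_symbol c p \<mu> (b n)"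
      "0 < im_symbol c p \<mu> (b n)" "b n < p"
    using eventually_happens'[OF sequentially_bot] by blast
  moreover have "0 < b n"
    by (simp add: b_def)
  ultimately show ?thesis
    using \<mu>(1) M(1) by (intro exI[of _ \<mu>] exI[of _ M] exI[of _ "b n"]) simp
qed

text \<open>The addition formula for the cosine: integration against the windowed kernel returns a
  combination of the same exponential times cosine and sine.\<close>

lemma window_integral:
  assumes "0 < \<beta>"
  shows "(LINT r|lebesgue. K r * (indicator {- (pi / \<beta>)..pi / \<beta>} r * (exp (- \<mu> * (s - r)) * cos (\<beta> * (s - r)))))
    = exp (- \<mu> * s) * (cos (\<beta> * s) * cos_moment \<mu> \<beta> + \<beta> * sin (\<beta> * s) * sin_moment \<mu> \<beta>)"
proof -
  let ?I = "indicator {- (pi / \<beta>)..pi / \<beta>} :: real \<Rightarrow> real"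
  have bd: "\<bar>?I r * (exp (\<mu> * r) * x)\<bar> \<le> C * exp (\<bar>\<mu>\<bar> * \<bar>r\<bar>)" if "\<bar>x\<bar> \<le> C" for r x C
  proof -
    have "exp (\<mu> * r) \<le> exp (\<bar>\<mu>\<bar> * \<bar>r\<bar>)"
      unfolding exp_le_cancel_iff by (metis abs_ge_self abs_mult)
    then have "\<bar>x\<bar> * exp (\<mu> * r) \<le> C * exp (\<bar>\<mu>\<bar> * \<bar>r\<bar>)"
      using that by (intro mult_mono) auto
    moreover have "0 \<le> C * exp (\<bar>\<mu>\<bar> * \<bar>r\<bar>)"
      using that by simp
    ultimately show ?thesis
      by (auto simp: indicator_def abs_mult mult.commute)
  qed
  have c: "integrable lebesgue (\<lambda>r. K r * (?I r * (exp (\<mu> * r) * cos (\<beta> * r))))"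
    by (rule integrable_times[of _ 1 "\<bar>\<mu>\<bar>"], measurable) (rule bd, simp)
  have "\<bar>sin (\<beta> * r) / \<beta>\<bar> \<le> 1 / \<beta>" for r
    using assms by (simp add: abs_divide divide_right_mono)
  then have s: "integrable lebesgue (\<lambda>r. K r * (?I r * (exp (\<mu> * r) * (sin (\<beta> * r) / \<beta>))))"
    by (intro integrable_times[of _ "1 / \<beta>" "\<bar>\<mu>\<bar>"], measurable) (rule bd)
  have "K r * (?I r * (exp (- \<mu> * (s - r)) * cos (\<beta> * (s - r))))
    = exp (- \<mu> * s) * cos (\<beta> * s) * (K r * (?I r * (exp (\<mu> * r) * cos (\<beta> * r))))
    + exp (- \<mu> * s) * (\<beta> * sin (\<beta> * s)) * (K r * (?I r * (exp (\<mu> * r) * (sin (\<beta> * r) / \<beta>))))" for r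
  proof -
    have e: "exp (- \<mu> * (s - r)) = exp (- \<mu> * s) * exp (\<mu> * r)"
      by (simp add: exp_add[symmetric] algebra_simps)
    have cs: "cos (\<beta> * (s - r)) = cos (\<beta> * s) * cos (\<beta> * r) + sin (\<beta> * s) * sin (\<beta> * r)"
      unfolding right_diff_distrib by (rule cos_diff)
    have "sin (\<beta> * r) = \<beta> * (sin (\<beta> * r) / \<beta>)"
      using assms by simp
    then show ?thesis
      unfolding e cs using assms by (simp add: algebra_simps)
  qed
  then have "(LINT r|lebesgue. K r * (?I r * (exp (- \<mu> * (s - r)) * cos (\<beta> * (s - r)))))
    = (LINT r|lebesgue. exp (- \<mu> * s) * cos (\<beta> * s) * (K r * (?I r * (exp (\<mu> * r) * cos (\<beta> * r))))
    + exp (- \<mu> * s) * (\<beta> * sin (\<beta> * s)) * (K r * (?I r * (exp (\<mu> * r) * (sin (\<beta> * r) / \<beta>)))))"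
    by (simp only:)
  also have "\<dots> = exp (- \<mu> * s) * cos (\<beta> * s) * cos_moment \<mu> \<beta>
    + exp (- \<mu> * s) * (\<beta> * sin (\<beta> * s)) * sin_moment \<mu> \<beta>"
    unfolding cos_moment_def sin_moment_def
    by (simp only: Bochner_Integration.integral_add[OF integrable_mult_right[OF c] integrable_mult_right[OF s]]
        integral_mult_right_zero)
  finally show ?thesis
    by (simp add: algebra_simps)
qed

end

section \<open>The explicit bump and its first two derivatives\<close>

definition wave :: "real \<Rightarrow> real \<Rightarrow> real \<Rightarrow> real" where
  "wave \<mu> \<beta> s = exp (- \<mu> * s) * cos (\<beta> * s)"

definition wave' :: "real \<Rightarrow> real \<Rightarrow> real \<Rightarrow> real" where
  "wave' \<mu> \<beta> s = exp (- \<mu> * s) * (- \<mu> * cos (\<beta> * s) - \<beta> * sin (\<beta> * s))"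

definition wave'' :: "real \<Rightarrow> real \<Rightarrow> real \<Rightarrow> real" where
  "wave'' \<mu> \<beta> s = exp (- \<mu> * s) * ((\<mu>\<^sup>2 - \<beta>\<^sup>2) * cos (\<beta> * s) + 2 * \<mu> * \<beta> * sin (\<beta> * s))"

lemma wave_deriv: "(wave \<mu> \<beta> has_real_derivative wave' \<mu> \<beta> s) (at s)"
  unfolding wave_def [abs_def] wave'_def
  by (auto intro!: derivative_eq_intros simp: algebra_simps)

lemma wave'_deriv: "(wave' \<mu> \<beta> has_real_derivative wave'' \<mu> \<beta> s) (at s)"
  unfolding wave'_def [abs_def] wave''_def
  by (auto intro!: derivative_eq_intros simp: algebra_simps power2_eq_square)

lemma continuous_wave: "continuous_on A (wave \<mu> \<beta>)"
  using wave_deriv by (intro DERIV_continuous_on) (auto intro: has_field_derivative_at_within)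

section \<open>Persistence\<close>

text \<open>The range is the one reached by \<open>\<beta> * (y - r)\<close> outside the central
  arch when \<open>\<bar>y\<bar> < pi / (2 * \<beta>)\<close> and
  \<open>\<bar>r\<bar> \<le> pi / \<beta>\<close>.\<close>

lemma cos_nonpos_outside:
  assumes "pi / 2 \<le> \<bar>x\<bar>" "\<bar>x\<bar> \<le> 3 * pi / 2"
  shows "cos x \<le> 0"
proof -
  have "0 \<le> cos (pi - \<bar>x\<bar>)"
    using assms by (intro cos_ge_zero) auto
  then show ?thesis
    by (simp add: cos_diff)
qed

context wave_profile
begin

text \<open>
  Once the profile has stayed above a small level \<open>\<epsilon>\<close> for long enough, it cannot come down to \<open>\<epsilon>\<close>:
  a multiple of the bump \<open>e\<^sup>-\<^sup>\<mu>\<^sup>s cos (\<beta> s)\<close>, started with positive slope at the point \<open>a\<close> where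
  \<open>tan (\<beta> a) = - M / \<beta>\<close>, can be placed below the profile to the right of the first hitting point.
\<close>

lemma no_descent:
  fixes p :: real
  assumes p: "0 < p"
    and F_pos: "\<And>\<mu>. 0 \<le> \<mu> \<Longrightarrow> 0 < \<mu>\<^sup>2 + c * \<mu> - 1 + p * (LINT r|lebesgue. K r * exp (\<mu> * r))"
    and lower: "\<And>p'. 0 < p' \<Longrightarrow> p' < p \<Longrightarrow> \<exists>\<delta>>0. \<forall>s\<in>{0..S}. p' * min s \<delta> \<le> g s"
  obtains T \<epsilon>0 where "0 < T" "0 < \<epsilon>0"
    "\<And>b \<epsilon>. \<lbrakk>0 < \<epsilon>; \<epsilon> \<le> \<epsilon>0; \<And>s. b - T \<le> s \<Longrightarrow> s \<le> b \<Longrightarrow> \<epsilon> \<le> \<phi> s; \<phi> b = \<epsilon>\<rbrakk> \<Longrightarrow> False"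
proof -
  obtain \<mu> M \<beta> where \<mu>: "0 \<le> \<mu>" and M: "\<mu> < M" and \<beta>: "0 < \<beta>" "\<beta> < p"
    and im: "0 < im_symbol c p \<mu> \<beta>" and re: "M * im_symbol c p \<mu> \<beta> < re_symbol c p \<mu> \<beta>"
    using ex_oscillating_exponent[OF p F_pos] by blast
  have "0 < p - \<beta>" "p - \<beta> < p"
    using \<beta> by auto
  then obtain \<delta> where \<delta>: "0 < \<delta>" "\<forall>s\<in>{0..S}. (p - \<beta>) * min s \<delta> \<le> g s"
    using lower by blast
  define R where "R = pi / 2 / \<beta>"
  define a where "a = - arctan (M / \<beta>) / \<beta>"
  have \<beta>R: "\<beta> * R = pi / 2" and \<beta>a: "\<beta> * a = - arctan (M / \<beta>)"
    using \<beta> by (auto simp: R_def a_def)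
  have M0: "0 < M / \<beta>"
    using \<mu> M \<beta> by simp
  have R0: "0 < R"
    using \<beta> by (simp add: R_def)
  have abs_less: "\<bar>\<beta> * x\<bar> < pi / 2 \<longleftrightarrow> - R < x \<and> x < R" for x
  proof -
    have "\<bar>\<beta> * x\<bar> < pi / 2 \<longleftrightarrow> \<beta> * \<bar>x\<bar> < \<beta> * R"
      using \<beta>(1) by (simp add: abs_mult \<beta>R)
    also have "\<dots> \<longleftrightarrow> \<bar>x\<bar> < R"
      using \<beta>(1) by (rule mult_less_cancel_left_pos)
    finally show ?thesis
      by (auto simp: abs_less_iff)
  qed
  have aR: "- R < a" "a < R"
    using abs_less[of a] arctan_bounded[of "M / \<beta>"] by (auto simp: \<beta>a)
  have wave_bound: "wave \<mu> \<beta> x \<le> exp (\<mu> * R)" if "- R \<le> x" for x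
  proof -
    have "wave \<mu> \<beta> x \<le> exp (- \<mu> * x) * 1"
      unfolding wave_def by (intro mult_left_mono) auto
    also have "- \<mu> * x \<le> \<mu> * R"
      using mult_left_mono[OF that \<mu>] by simp
    then have "exp (- \<mu> * x) * 1 \<le> exp (\<mu> * R)"
      by simp
    finally show ?thesis .
  qed
  have cos_pos: "0 < cos (\<beta> * x)" if "- R < x" "x < R" for x
    using abs_less[of x] that by (intro cos_gt_zero_pi) auto
  have wave_pos: "0 < wave \<mu> \<beta> x" if "- R < x" "x < R" for x
    using cos_pos[OF that] by (simp add: wave_def)
  have sin_tan: "sin (\<beta> * x) = tan (\<beta> * x) * cos (\<beta> * x)" if "- R < x" "x < R" for x
    using cos_pos[OF that] by (simp add: tan_def)
  have tan_a: "tan (\<beta> * a) = - (M / \<beta>)"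
    unfolding \<beta>a by (simp add: tan_arctan)
  have tan_mono: "tan (\<beta> * x) \<le> tan (\<beta> * y)" if "- R < x" "x \<le> y" "y < R" for x y
    using that abs_less[of x] abs_less[of y] \<beta> by (intro tan_mono_le) auto
  \<comment> \<open>The logarithmic derivative of the bump is
    \<open>- \<mu> - \<beta> * tan (\<beta> * x)\<close>. It equals \<open>M - \<mu> > 0\<close> at
    \<open>a\<close> and is larger further left.\<close>
  have wave'_ge: "(M - \<mu>) * wave \<mu> \<beta> x \<le> wave' \<mu> \<beta> x" if "- R < x" "x \<le> a" for x
  proof -
    have xR: "x < R"
      using that aR by simp
    have "tan (\<beta> * x) \<le> - (M / \<beta>)"
      using tan_mono[of x a] that aR tan_a by simp
    then have "M \<le> - \<mu> - \<beta> * tan (\<beta> * x) + \<mu>"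
      using \<beta> by (simp add: field_simps)
    then have "(M - \<mu>) * wave \<mu> \<beta> x \<le> (- \<mu> - \<beta> * tan (\<beta> * x)) * wave \<mu> \<beta> x"
      using wave_pos[OF that(1) xR] by (intro mult_right_mono) auto
    also have "\<dots> = wave' \<mu> \<beta> x"
      unfolding wave_def wave'_def sin_tan[OF that(1) xR] by (simp add: algebra_simps)
    finally show ?thesis .
  qed
  have wave_le_a: "wave \<mu> \<beta> x \<le> wave \<mu> \<beta> a" if "- R \<le> x" "x \<le> a" for x
  proof (rule DERIV_nonneg_imp_increasing_open[OF that(2)])
    fix y assume y: "x < y" "y < a"
    then have "0 \<le> (M - \<mu>) * wave \<mu> \<beta> y"
      using M wave_pos[of y] that aR by simp
    then have "0 \<le> wave' \<mu> \<beta> y"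
      using wave'_ge[of y] y that by simp
    then show "\<exists>d. (wave \<mu> \<beta> has_real_derivative d) (at y) \<and> 0 \<le> d"
      using wave_deriv by blast
  qed (rule continuous_wave)
  have wa: "0 < wave \<mu> \<beta> a"
    using wave_pos aR by simp
  \<comment> \<open>Divided by the bump, the expression is
    \<open>re_symbol + im_symbol * (\<beta> * tan (\<beta> * x))\<close>. To the right of
    \<open>a\<close> the last factor is at least \<open>- M\<close>, so
    \<open>M * im_symbol < re_symbol\<close> decides the sign.\<close>
  have subsolution: "0 < wave'' \<mu> \<beta> x - c * wave' \<mu> \<beta> x - wave \<mu> \<beta> x + (p - \<beta>) *
      (exp (- \<mu> * x) * (cos (\<beta> * x) * cos_moment \<mu> \<beta> + \<beta> * sin (\<beta> * x) * sin_moment \<mu> \<beta>))"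
    if "a \<le> x" "x < R" for x
  proof -
    have x: "- R < x" "x < R"
      using that aR by auto
    have "- (M / \<beta>) \<le> tan (\<beta> * x)"
      using tan_mono[of a x] that aR tan_a by simp
    then have "- M \<le> \<beta> * tan (\<beta> * x)"
      using \<beta> by (simp add: field_simps)
    then have "im_symbol c p \<mu> \<beta> * (- M) \<le> im_symbol c p \<mu> \<beta> * (\<beta> * tan (\<beta> * x))"
      using im by (intro mult_left_mono) auto
    then have "0 < re_symbol c p \<mu> \<beta> + im_symbol c p \<mu> \<beta> * (\<beta> * tan (\<beta> * x))"
      using re by (simp add: algebra_simps)
    then have "0 < wave \<mu> \<beta> x * (re_symbol c p \<mu> \<beta> + im_symbol c p \<mu> \<beta> * (\<beta> * tan (\<beta> * x)))"
      using wave_pos[OF x] by simp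
    also have "\<dots> = wave'' \<mu> \<beta> x - c * wave' \<mu> \<beta> x - wave \<mu> \<beta> x + (p - \<beta>) *
      (exp (- \<mu> * x) * (cos (\<beta> * x) * cos_moment \<mu> \<beta> + \<beta> * sin (\<beta> * x) * sin_moment \<mu> \<beta>))"
      unfolding wave_def wave'_def wave''_def re_symbol_def im_symbol_def sin_tan[OF x]
      by (simp add: algebra_simps power2_eq_square)
    finally show ?thesis .
  qed
  \<comment> \<open>Chosen so that the multiple of the bump with value at most
    \<open>\<epsilon>0\<close> at \<open>a\<close> stays below \<open>\<delta>\<close> on all of
    \<open>[- R, R]\<close>, where the linear bound for \<open>g\<close> is uncapped.\<close>
  define \<epsilon>0 where "\<epsilon>0 = \<delta> * wave \<mu> \<beta> a / exp (\<mu> * R)"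
  \<comment> \<open>The distance from the left zero of the bump to \<open>a\<close>: the stretch on
    which the level must bound the profile.\<close>
  define T where "T = a + R"
  have "0 < T" "0 < \<epsilon>0"
    using aR \<delta> wa by (auto simp: T_def \<epsilon>0_def)
  moreover have False
    if \<epsilon>: "0 < \<epsilon>" "\<epsilon> \<le> \<epsilon>0" and left: "\<And>s. b - T \<le> s \<Longrightarrow> s \<le> b \<Longrightarrow> \<epsilon> \<le> \<phi> s" and hit: "\<phi> b = \<epsilon>" for b \<epsilon>
  proof -
    define \<Phi> where "\<Phi> s = \<phi> (s + (b - a))" for s
    define \<Phi>' where "\<Phi>' s = \<phi>' (s + (b - a))" for s
    define \<Phi>'' where "\<Phi>'' s = \<phi>'' (s + (b - a))" for s
    have \<Phi>: "(\<Phi> has_real_derivative \<Phi>' s) (at s)" for s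
      using deriv1[of "s + (b - a)"] unfolding \<Phi>_def[abs_def] \<Phi>'_def DERIV_shift .
    have \<Phi>': "(\<Phi>' has_real_derivative \<Phi>'' s) (at s)" for s
      using deriv2[of "s + (b - a)"] unfolding \<Phi>'_def[abs_def] \<Phi>''_def DERIV_shift .
    have \<Phi>_pos: "0 < \<Phi> s" for s
      using \<phi>_pos by (simp add: \<Phi>_def)
    have \<Phi>a: "\<Phi> a = \<epsilon>"
      using hit by (simp add: \<Phi>_def)
    have \<Phi>_left: "\<epsilon> \<le> \<Phi> s" if "- R \<le> s" "s \<le> a" for s
      unfolding \<Phi>_def using that by (intro left) (auto simp: T_def)
    define k where "k = \<epsilon> / wave \<mu> \<beta> a"
    have k: "0 < k" "k * wave \<mu> \<beta> a = \<epsilon>"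
      using \<epsilon> wa by (auto simp: k_def)
    have "k * exp (\<mu> * R) \<le> \<epsilon>0 / wave \<mu> \<beta> a * exp (\<mu> * R)"
      unfolding k_def using \<epsilon> wa by (intro mult_right_mono divide_right_mono) auto
    also have "\<dots> = \<delta>"
      using wa by (simp add: \<epsilon>0_def)
    finally have k\<delta>: "k * exp (\<mu> * R) \<le> \<delta>" .
    have above: "k * wave \<mu> \<beta> x \<le> \<Phi> x" if x: "a \<le> x" "x \<le> R" for x
    proof (rule ccontr)
      assume neg: "\<not> ?thesis"
      \<comment> \<open>A maximum \<open>y\<close> of this ratio gives the touching multiple
        \<open>j = 1 / \<rho> y\<close>. It is smaller than \<open>k\<close>, because a violation
        makes the ratio exceed \<open>1 / k\<close>; this excludes \<open>y = a\<close>, and the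
        zero of the cosine excludes \<open>y = R\<close>.\<close>
      define \<rho> where "\<rho> y = wave \<mu> \<beta> y / \<Phi> y" for y
      have "continuous_on {a..R} \<rho>"
        unfolding \<rho>_def
      proof (intro continuous_on_divide continuous_wave ballI)
        show "continuous_on {a..R} \<Phi>"
          using \<Phi> by (intro DERIV_continuous_on) (rule has_field_derivative_at_within)
        show "\<Phi> t \<noteq> 0" for t
          using \<Phi>_pos[of t] by simp
      qed
      then obtain y where y: "y \<in> {a..R}" "\<And>t. t \<in> {a..R} \<Longrightarrow> \<rho> t \<le> \<rho> y"
        using continuous_attains_sup[of "{a..R}" \<rho>] aR by auto
      have "1 / k < \<rho> x"
        using neg \<Phi>_pos[of x] k by (simp add: \<rho>_def field_simps)
      also have "\<dots> \<le> \<rho> y"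
        using x by (intro y) auto
      finally have \<rho>y: "1 / k < \<rho> y" .
      have "0 < \<rho> y"
        using k by (intro order.strict_trans[OF _ \<rho>y]) auto
      have "y \<noteq> R"
        using \<open>0 < \<rho> y\<close> by (auto simp: \<rho>_def wave_def \<beta>R)
      moreover have "\<rho> a = 1 / k"
        using k wa \<epsilon> by (simp add: \<rho>_def \<Phi>a k_def)
      then have "y \<noteq> a"
        using \<rho>y by auto
      ultimately have yy: "a < y" "y < R"
        using y(1) by (auto simp: order.order_iff_strict)
      define j where "j = 1 / \<rho> y"
      have j: "0 < j" "j < k"
        using \<open>0 < \<rho> y\<close> \<rho>y k(1) by (auto simp: j_def field_simps)
      have jy: "j * wave \<mu> \<beta> y = \<Phi> y"
        using wave_pos[of y] yy aR by (simp add: j_def \<rho>_def)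
      have j_right: "j * wave \<mu> \<beta> t \<le> \<Phi> t" if "a \<le> t" "t \<le> R" for t
        using y(2)[of t] that \<Phi>_pos[of t] \<open>0 < \<rho> y\<close> by (simp add: j_def \<rho>_def[of t] field_simps)
      \<comment> \<open>Left of \<open>a\<close> there is no touching argument; there the bump is
        increasing, so its multiple stays below the value \<open>\<epsilon>\<close> at
        \<open>a\<close>, hence below the profile.\<close>
      have j_below: "j * wave \<mu> \<beta> t \<le> min (\<Phi> t) \<delta>" if "- R \<le> t" "t \<le> R" for t
      proof -
        have "j * wave \<mu> \<beta> t \<le> \<Phi> t"
        proof (cases "a \<le> t")
          case False
          then have "j * wave \<mu> \<beta> t \<le> j * wave \<mu> \<beta> a"
            using that j by (intro mult_left_mono wave_le_a) auto
          also have "\<dots> \<le> k * wave \<mu> \<beta> a"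
            using j wa by (intro mult_right_mono) auto
          also have "\<dots> \<le> \<Phi> t"
            using \<Phi>_left[of t] that False k by simp
          finally show ?thesis .
        qed (use j_right that in auto)
        moreover have "j * wave \<mu> \<beta> t \<le> k * exp (\<mu> * R)"
        proof -
          have "j * wave \<mu> \<beta> t \<le> j * exp (\<mu> * R)"
            using j that by (intro mult_left_mono wave_bound) auto
          also have "\<dots> \<le> k * exp (\<mu> * R)"
            using j by (intro mult_right_mono) auto
          finally show ?thesis .
        qed
        ultimately show ?thesis
          using k\<delta> by simp
      qed
      define f where "f t = \<Phi> t - j * wave \<mu> \<beta> t" for t
      define f' where "f' t = \<Phi>' t - j * wave' \<mu> \<beta> t" for t
      have f: "(f has_real_derivative f' t) (at t)" for t
        unfolding f_def[abs_def] f'_def by (auto intro!: derivative_eq_intros \<Phi> wave_deriv)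
      have f': "(f' has_real_derivative \<Phi>'' y - j * wave'' \<mu> \<beta> y) (at y)"
        unfolding f'_def[abs_def] by (auto intro!: derivative_eq_intros \<Phi>' wave'_deriv)
      have min: "f y \<le> f t" if "a < t" "t < R" for t
        using j_right[of t] jy that by (simp add: f_def)
      have "f' y = 0" "0 \<le> \<Phi>'' y - j * wave'' \<mu> \<beta> y"
        by (rule first_derivative_at_min[OF f f' yy min] second_derivative_at_min[OF f f' yy min]; assumption)+
      then have d: "\<Phi>' y = j * wave' \<mu> \<beta> y" "j * wave'' \<mu> \<beta> y \<le> \<Phi>'' y"
        by (auto simp: f'_def)
      \<comment> \<open>The lower bound for the source keeps the full cosine inside the window,
        negative parts included, so that \<open>window_integral\<close> evaluates it
        exactly.\<close>
      define q where "q r = (p - \<beta>) * j * (indicator {- (pi / \<beta>)..pi / \<beta>} r * wave \<mu> \<beta> (y - r))" for r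
      have "(LINT r|lebesgue. K r * q r) \<le> (LINT r|lebesgue. K r * g (\<phi> (y + (b - a) - r)))"
      proof (rule integral_ge)
        have "(\<lambda>r. wave \<mu> \<beta> (y - r)) \<in> borel_measurable lebesgue"
        proof (intro measurable_completion)
          have "continuous_on UNIV (\<lambda>r. wave \<mu> \<beta> (y - r))"
            by (rule continuous_on_compose2[OF continuous_wave[of UNIV]]) (auto intro: continuous_intros)
          then show "(\<lambda>r. wave \<mu> \<beta> (y - r)) \<in> borel_measurable lborel"
            by (simp add: borel_measurable_continuous_onI)
        qed
        then show "q \<in> borel_measurable lebesgue"
          unfolding q_def[abs_def] by measurable
        show "\<bar>q r\<bar> \<le> (p - \<beta>) * j * exp (\<mu> * (\<bar>y\<bar> + pi / \<beta>))" for r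
        proof -
          have "\<bar>indicator {- (pi / \<beta>)..pi / \<beta>} r * wave \<mu> \<beta> (y - r)\<bar> \<le> exp (\<mu> * (\<bar>y\<bar> + pi / \<beta>))"
          proof (cases "r \<in> {- (pi / \<beta>)..pi / \<beta>}")
            case True
            have "\<mu> * (r - y) \<le> \<mu> * (\<bar>y\<bar> + pi / \<beta>)"
              using True \<mu> by (intro mult_left_mono) auto
            then have "exp (- \<mu> * (y - r)) * \<bar>cos (\<beta> * (y - r))\<bar> \<le> exp (\<mu> * (\<bar>y\<bar> + pi / \<beta>)) * 1"
              by (intro mult_mono) (auto simp: algebra_simps)
            then show ?thesis
              using True by (simp add: wave_def abs_mult)
          qed simp
          then show ?thesis
            using \<beta> j by (simp add: q_def abs_mult)
        qed
        show "q r \<le> g (\<phi> (y + (b - a) - r))" for r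
        proof -
          have \<Phi>r: "\<phi> (y + (b - a) - r) = \<Phi> (y - r)"
            unfolding \<Phi>_def by (simp add: algebra_simps)
          have g0: "0 \<le> g (\<Phi> (y - r))"
            using g_nonneg \<Phi>_pos less_imp_le by blast
          \<comment> \<open>Outside the window the bound is 0; on the central arch
            \<open>j_below\<close> applies; elsewhere in the window the cosine is nonpositive and
            \<open>g \<ge> 0\<close> is enough.\<close>
          consider "r \<notin> {- (pi / \<beta>)..pi / \<beta>}" | "r \<in> {- (pi / \<beta>)..pi / \<beta>}" "\<bar>y - r\<bar> \<le> R"
            | "r \<in> {- (pi / \<beta>)..pi / \<beta>}" "R < \<bar>y - r\<bar>"
            by linarith
          then show ?thesis
          proof cases
            case 1
            then have "q r = 0"
              by (simp add: q_def)
            then show ?thesis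
              using g0 \<Phi>r by simp
          next
            case 2
            then have "q r = (p - \<beta>) * (j * wave \<mu> \<beta> (y - r))"
              by (simp add: q_def)
            also have "\<dots> \<le> (p - \<beta>) * min (\<Phi> (y - r)) \<delta>"
              using 2(2) \<beta> by (intro mult_left_mono j_below) auto
            also have "\<dots> \<le> g (\<Phi> (y - r))"
              using bspec[OF \<delta>(2) profile_mem[of "y + (b - a) - r"]] \<Phi>r by simp
            finally show ?thesis
              using \<Phi>r by simp
          next
            case 3
            have "\<bar>y - r\<bar> \<le> 3 * R"
              using 3(1) yy aR by (auto simp: R_def)
            then have "\<beta> * \<bar>y - r\<bar> \<le> \<beta> * (3 * R)"
              using \<beta> by (intro mult_left_mono) auto
            moreover have "\<beta> * R \<le> \<beta> * \<bar>y - r\<bar>"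
              using \<beta> 3(2) by (intro mult_left_mono) auto
            moreover have "\<beta> * (3 * R) = 3 * pi / 2" "\<bar>\<beta> * (y - r)\<bar> = \<beta> * \<bar>y - r\<bar>"
              using \<beta> \<beta>R by (simp_all add: abs_mult mult.commute)
            ultimately have "cos (\<beta> * (y - r)) \<le> 0"
              using \<beta>R by (intro cos_nonpos_outside) simp_all
            then have "wave \<mu> \<beta> (y - r) \<le> 0"
              by (simp add: wave_def mult_nonneg_nonpos)
            moreover have "q r = (p - \<beta>) * j * wave \<mu> \<beta> (y - r)"
              using 3(1) by (simp add: q_def)
            ultimately have "q r \<le> 0"
              using \<beta> j by (simp add: mult_nonneg_nonpos)
            then show ?thesis
              using g0 \<Phi>r by simp
          qed
        qed
      qed
      also have "(LINT r|lebesgue. K r * q r) = (p - \<beta>) * j *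
          (exp (- \<mu> * y) * (cos (\<beta> * y) * cos_moment \<mu> \<beta> + \<beta> * sin (\<beta> * y) * sin_moment \<mu> \<beta>))"
      proof -
        have "(\<lambda>r. K r * q r) = (\<lambda>r. (p - \<beta>) * j *
            (K r * (indicator {- (pi / \<beta>)..pi / \<beta>} r * (exp (- \<mu> * (y - r)) * cos (\<beta> * (y - r))))))"
          by (simp add: q_def wave_def fun_eq_iff)
        then show ?thesis
          using window_integral[OF \<beta>(1), of \<mu> y] by (simp only: integral_mult_right_zero)
      qed
      finally have "j * (wave'' \<mu> \<beta> y - c * wave' \<mu> \<beta> y - wave \<mu> \<beta> y + (p - \<beta>) *
          (exp (- \<mu> * y) * (cos (\<beta> * y) * cos_moment \<mu> \<beta> + \<beta> * sin (\<beta> * y) * sin_moment \<mu> \<beta>))) \<le> 0"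
        using profile_eq[of "y + (b - a)"] d jy unfolding \<Phi>_def \<Phi>'_def \<Phi>''_def by (simp add: algebra_simps)
      moreover have "0 < j * (wave'' \<mu> \<beta> y - c * wave' \<mu> \<beta> y - wave \<mu> \<beta> y + (p - \<beta>) *
          (exp (- \<mu> * y) * (cos (\<beta> * y) * cos_moment \<mu> \<beta> + \<beta> * sin (\<beta> * y) * sin_moment \<mu> \<beta>)))"
        using j(1) subsolution[of y] yy by (intro mult_pos_pos) auto
      ultimately show False
        by linarith
    qed
    \<comment> \<open>The bump lies below the profile to the right of \<open>a\<close> and meets it
      at \<open>a\<close>, so the slopes are ordered there. The profile therefore increases at
      \<open>a\<close> and was below \<open>\<epsilon>\<close> just before, contrary to the
      assumption on the left.\<close>
    have "k * wave' \<mu> \<beta> a \<le> \<Phi>' a"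
    proof (rule ccontr)
      assume "\<not> ?thesis"
      then have neg: "\<Phi>' a - k * wave' \<mu> \<beta> a < 0"
        by simp
      have "((\<lambda>t. \<Phi> t - k * wave \<mu> \<beta> t) has_real_derivative \<Phi>' a - k * wave' \<mu> \<beta> a) (at a)"
        by (auto intro!: derivative_eq_intros \<Phi> wave_deriv)
      from DERIV_neg_dec_right[OF this neg] obtain d where d: "0 < d" "\<And>t. 0 < t \<Longrightarrow> t < d \<Longrightarrow>
          \<Phi> (a + t) - k * wave \<mu> \<beta> (a + t) < \<Phi> a - k * wave \<mu> \<beta> a"
        by blast
      define t where "t = min d (R - a) / 2"
      have "2 * t \<le> R - a" "0 < t" "t < d"
        using d(1) aR by (auto simp: t_def)
      then have "0 < t" "t < d" "a + t \<le> R"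
        by linarith+
      then show False
        using d(2)[of t] above[of "a + t"] k \<Phi>a by simp
    qed
    moreover have "0 < k * wave' \<mu> \<beta> a"
    proof -
      have "0 < (M - \<mu>) * wave \<mu> \<beta> a"
        using M wa by simp
      also have "\<dots> \<le> wave' \<mu> \<beta> a"
        using wave'_ge[of a] aR by simp
      finally show ?thesis
        using k by simp
    qed
    ultimately have "0 < \<Phi>' a"
      by simp
    then obtain d where d: "0 < d" "\<And>t. 0 < t \<Longrightarrow> t < d \<Longrightarrow> \<Phi> (a - t) < \<Phi> a"
      using DERIV_pos_inc_left[OF \<Phi>] by blast
    define t where "t = min d (a + R) / 2"
    have "2 * t \<le> a + R" "0 < t" "t < d"
      using d(1) aR by (auto simp: t_def)
    then have "0 < t" "t < d" "- R \<le> a - t"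
      using aR by linarith+
    then show False
      using d(2)[of t] \<Phi>_left[of "a - t"] \<Phi>a by simp
  qed
  ultimately show thesis
    using that by blast
qed

text \<open>The level is taken below the minimum of the profile on \<open>[0, T]\<close>. A first
  hitting point then comes after \<open>T\<close> and has a full interval of length \<open>T\<close>
  above the level behind it, which \<open>no_descent\<close> forbids.\<close>

lemma persistence:
  fixes p :: real
  assumes p: "0 < p"
    and F_pos: "\<And>\<mu>. 0 \<le> \<mu> \<Longrightarrow> 0 < \<mu>\<^sup>2 + c * \<mu> - 1 + p * (LINT r|lebesgue. K r * exp (\<mu> * r))"
    and lower: "\<And>p'. 0 < p' \<Longrightarrow> p' < p \<Longrightarrow> \<exists>\<delta>>0. \<forall>s\<in>{0..S}. p' * min s \<delta> \<le> g s"
    and z: "0 < z"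
  shows "\<exists>\<epsilon>>0. \<epsilon> \<le> z \<and> (\<forall>s\<ge>0. \<epsilon> \<le> \<phi> s)"
proof -
  obtain T \<epsilon>0 where T: "0 < T" and \<epsilon>0: "0 < \<epsilon>0" and no_hit:
    "\<And>b \<epsilon>. \<lbrakk>0 < \<epsilon>; \<epsilon> \<le> \<epsilon>0; \<And>s. b - T \<le> s \<Longrightarrow> s \<le> b \<Longrightarrow> \<epsilon> \<le> \<phi> s; \<phi> b = \<epsilon>\<rbrakk> \<Longrightarrow> False"
    using no_descent[OF p F_pos lower] by blast
  have "\<exists>x\<in>{0..T}. \<forall>t\<in>{0..T}. \<phi> x \<le> \<phi> t"
    using T by (intro continuous_attains_inf continuous_profile) auto
  then obtain x where x: "\<And>t. t \<in> {0..T} \<Longrightarrow> \<phi> x \<le> \<phi> t"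
    by blast
  \<comment> \<open>Halving makes the level strictly smaller than the minimum on
    \<open>[0, T]\<close>, so it is not attained there.\<close>
  define \<epsilon> where "\<epsilon> = min (\<phi> x / 2) (min \<epsilon>0 z)"
  have \<epsilon>: "0 < \<epsilon>" "\<epsilon> < \<phi> x" "\<epsilon> \<le> \<epsilon>0" "\<epsilon> \<le> z"
    using \<phi>_pos[of x] \<epsilon>0 z by (auto simp: \<epsilon>_def)
  have "\<epsilon> \<le> \<phi> s" if "0 \<le> s" for s
  proof (rule ccontr)
    assume neg: "\<not> \<epsilon> \<le> \<phi> s"
    define X where "X = {t \<in> {0..s}. \<phi> t \<le> \<epsilon>}"
    have "closed X"
      unfolding X_def by (intro continuous_on_closed_Collect_le continuous_profile continuous_on_const) auto
    moreover have "bounded X"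
      unfolding X_def by (rule bounded_subset[of "{0..s}"]) auto
    ultimately have "compact X"
      by (simp add: compact_eq_bounded_closed)
    moreover have "s \<in> X"
      using that neg by (simp add: X_def)
    ultimately obtain b where b: "b \<in> X" "\<And>t. t \<in> X \<Longrightarrow> b \<le> t"
      using compact_attains_inf[of X] by blast
    have b': "0 \<le> b" "b \<le> s" "\<phi> b \<le> \<epsilon>"
      using b(1) by (auto simp: X_def)
    have "T < b"
    proof (rule ccontr)
      assume "\<not> T < b"
      then have "\<phi> x \<le> \<phi> b"
        using b'(1) by (intro x) auto
      then show False
        using \<epsilon>(2) b'(3) by simp
    qed
    have before: "\<epsilon> < \<phi> t" if "0 \<le> t" "t < b" for t
      using b(2)[of t] that b'(2) by (force simp: X_def)
    have "\<phi> b = \<epsilon>"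
    proof -
      have "\<epsilon> < \<phi> 0"
        using before[of 0] \<open>T < b\<close> T by simp
      then obtain t where t: "0 \<le> t" "t \<le> b" "\<phi> t = \<epsilon>"
        using IVT2'[of \<phi> b \<epsilon> 0] b' continuous_profile by auto
      then show ?thesis
        using before[of t] by (cases "t = b") auto
    qed
    moreover have "\<epsilon> \<le> \<phi> t" if "b - T \<le> t" "t \<le> b" for t
      using before[of t] that \<open>T < b\<close> \<open>\<phi> b = \<epsilon>\<close> by (cases "t = b") auto
    ultimately show False
      using no_hit[of \<epsilon> b] \<epsilon> by blast
  qed
  with \<epsilon> show ?thesis
    by blast
qed

end

section \<open>Absorbing the delay, the birth function beyond the invariant interval, and the
  conclusion\<close>

lemma (in exp_kernel) translate: "exp_kernel (\<lambda>r. K (r - a))"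
proof
  show "0 \<le> K (s - a)" for s
    by (rule nonneg)
  show "(LINT r|lebesgue. K (r - a)) = 1"
    using lebesgue_integral_real_affine[of 1 K "- a"] mass by simp
  show "integrable lebesgue (\<lambda>r. K (r - a) * exp (\<mu> * r))" for \<mu>
  proof -
    have "integrable lebesgue (\<lambda>r. exp (\<mu> * a) * (K (- a + 1 * r) * exp (\<mu> * (- a + 1 * r))))"
      by (intro integrable_mult_right lebesgue_integrable_real_affine exp_moments) auto
    moreover have "exp (\<mu> * a) * (K (- a + 1 * r) * exp (\<mu> * (- a + 1 * r))) = K (r - a) * exp (\<mu> * r)" for r
      by (simp add: exp_add[symmetric] algebra_simps)
    ultimately show ?thesis
      by (simp only:)
  qed
qed

text \<open>For \<open>a = c * h\<close> and \<open>\<mu> = - l\<close> the factor is exactly the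
  delay term \<open>exp (- l * c * h)\<close> of \<open>disp\<close>.\<close>

lemma (in exp_kernel) integral_translate_exp:
  "(LINT r|lebesgue. K (r - a) * exp (\<mu> * r)) = exp (\<mu> * a) * (LINT r|lebesgue. K r * exp (\<mu> * r))"
proof -
  have "(LINT r|lebesgue. K r * exp (\<mu> * r)) = (LINT r|lebesgue. K (r - a) * exp (\<mu> * (r - a)))"
    using lebesgue_integral_real_affine[of 1 "\<lambda>r. K r * exp (\<mu> * r)" "- a"] by simp
  also have "exp (\<mu> * a) * \<dots> = (LINT r|lebesgue. exp (\<mu> * a) * (K (r - a) * exp (\<mu> * (r - a))))"
    by simp
  also have "\<dots> = (LINT r|lebesgue. K (r - a) * exp (\<mu> * r))"
  proof (rule Bochner_Integration.integral_cong)
    show "exp (\<mu> * a) * (K (r - a) * exp (\<mu> * (r - a))) = K (r - a) * exp (\<mu> * r)" for r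
      by (simp add: exp_add[symmetric] algebra_simps)
  qed simp
  finally show ?thesis ..
qed

text \<open>Everything is read off at time 0, where the chain rule turns the time derivative into
  \<open>c\<close> times the space derivative.\<close>

lemma travelling_wave_profile:
  assumes "classical_solution h K g (\<lambda>t x. \<phi> (x + c * t))"
  obtains \<phi>' \<phi>'' where
    "\<And>s. (\<phi> has_real_derivative \<phi>' s) (at s)"
    "\<And>s. (\<phi>' has_real_derivative \<phi>'' s) (at s)"
    "\<And>s. \<phi>'' s - c * \<phi>' s - \<phi> s + (LINT r|lebesgue. K (r - c * h) * g (\<phi> (s - r))) = 0"
proof -
  obtain ut ux uxx where
    t: "\<And>t x. ((\<lambda>\<tau>. \<phi> (x + c * \<tau>)) has_real_derivative ut t x) (at t)" and
    x: "\<And>t x. ((\<lambda>\<xi>. \<phi> (\<xi> + c * t)) has_real_derivative ux t x) (at x)" and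
    xx: "\<And>t x. ((\<lambda>\<xi>. ux t \<xi>) has_real_derivative uxx t x) (at x)" and
    eq: "\<And>t x. ut t x = uxx t x - \<phi> (x + c * t) + (LINT y|lebesgue. K (x - y) * g (\<phi> (y + c * (t - h))))"
    using assms unfolding classical_solution_def by blast
  have d1: "(\<phi> has_real_derivative ux 0 s) (at s)" for s
    using x[of 0 s] by simp
  have d2: "(ux 0 has_real_derivative uxx 0 s) (at s)" for s
    using xx[of 0 s] by simp
  have ut: "ut 0 s = c * ux 0 s" for s
  proof (rule DERIV_unique[OF t])
    have "((\<lambda>\<tau>. s + c * \<tau>) has_real_derivative c) (at 0)"
      by (auto intro!: derivative_eq_intros)
    then have "((\<lambda>\<tau>. \<phi> (s + c * \<tau>)) has_real_derivative ux 0 (s + c * 0) * c) (at 0)"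
      by (rule DERIV_chain2[OF d1])
    then show "((\<lambda>\<tau>. \<phi> (s + c * \<tau>)) has_real_derivative c * ux 0 s) (at 0)"
      by (simp add: mult.commute)
  qed
  \<comment> \<open>Substitution \<open>y = s + c * h - r\<close>: the delay leaves the argument of
    the profile and becomes a translation of the kernel.\<close>
  have "(LINT y|lebesgue. K (s - y) * g (\<phi> (y + c * (0 - h)))) = (LINT r|lebesgue. K (r - c * h) * g (\<phi> (s - r)))" for s
    using lebesgue_integral_real_affine[of "- 1" "\<lambda>y. K (s - y) * g (\<phi> (y + c * (0 - h)))" "s + c * h"]
    by (simp add: algebra_simps)
  then have "uxx 0 s - c * ux 0 s - \<phi> s + (LINT r|lebesgue. K (r - c * h) * g (\<phi> (s - r))) = 0" for s
    using eq[of 0 s] ut[of s] by simp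
  then show thesis
    using that d1 d2 by blast
qed

text \<open>Beyond \<open>\<zeta>\<^sub>2\<close> the function \<open>g\<close> may drop low, but
  then \<open>S\<close> cannot be that large. The fixed point \<open>\<kappa>\<close> lies in
  \<open>[\<zeta>\<^sub>1, \<zeta>\<^sub>2]\<close>, so \<open>g t - t\<close> has one sign beyond
  \<open>\<zeta>\<^sub>2\<close>. A low value makes it negative, and then \<open>g < S\<close> on
  \<open>[0, S]\<close>, against \<open>S\<close> being at most the maximum of \<open>g\<close>
  there.\<close>

lemma birth_function_beyond:
  fixes g :: "real \<Rightarrow> real"
  assumes cont: "continuous_on {0..} g"
    and zeta: "0 < \<zeta>\<^sub>1" "\<zeta>\<^sub>1 < \<zeta>\<^sub>2"
    and inv: "g ` {\<zeta>\<^sub>1..\<zeta>\<^sub>2} \<subseteq> {\<zeta>\<^sub>1..\<zeta>\<^sub>2}" "g ` {0..\<zeta>\<^sub>1} \<subseteq> {0..\<zeta>\<^sub>2}"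
    and min: "\<And>s. s \<in> {\<zeta>\<^sub>1..\<zeta>\<^sub>2} \<Longrightarrow> g \<zeta>\<^sub>1 \<le> g s"
    and above: "\<zeta>\<^sub>1 < g \<zeta>\<^sub>1"
    and fixpoints: "{s. 0 \<le> s \<and> g s = s} = {0, \<kappa>}"
    and S: "0 \<le> S" "\<And>B. (\<And>s. 0 \<le> s \<Longrightarrow> s \<le> S \<Longrightarrow> g s \<le> B) \<Longrightarrow> S \<le> B"
    and s: "\<zeta>\<^sub>1 \<le> s" "s \<le> S"
  shows "\<zeta>\<^sub>1 < g s"
proof (cases "s \<le> \<zeta>\<^sub>2")
  case True
  then show ?thesis
    using min[of s] above s by simp
next
  case False
  have cont': "continuous_on {a..b} (\<lambda>s. g s - s)" if "0 \<le> a" for a b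
    using that by (intro continuous_intros continuous_on_subset[OF cont]) auto
  have "g \<zeta>\<^sub>2 \<in> {\<zeta>\<^sub>1..\<zeta>\<^sub>2}"
    using inv(1) zeta by (simp add: image_subset_iff)
  then have "g \<zeta>\<^sub>2 \<le> \<zeta>\<^sub>2"
    by simp
  then obtain k where k: "\<zeta>\<^sub>1 \<le> k" "k \<le> \<zeta>\<^sub>2" "g k - k = 0"
    using IVT2'[of "\<lambda>s. g s - s" \<zeta>\<^sub>2 0 \<zeta>\<^sub>1] above zeta cont'[OF less_imp_le[OF zeta(1)]] by auto
  then have "k \<in> {s. 0 \<le> s \<and> g s = s}"
    using zeta by simp
  then have "k = \<kappa>"
    using fixpoints k(1) zeta by auto
  have no_fix: "g t \<noteq> t" if "\<zeta>\<^sub>2 < t" for t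
  proof
    assume "g t = t"
    then have "t \<in> {s. 0 \<le> s \<and> g s = s}"
      using that zeta by simp
    then show False
      using fixpoints \<open>k = \<kappa>\<close> k that zeta by auto
  qed
  show ?thesis
  proof (rule ccontr)
    assume "\<not> \<zeta>\<^sub>1 < g s"
    then have gs: "g s < s"
      using False zeta by simp
    \<comment> \<open>A point above the diagonal would produce another fixed point between it and
      \<open>s\<close>, on either side.\<close>
    have below: "g t < t" if "\<zeta>\<^sub>2 < t" for t
    proof (rule ccontr)
      assume "\<not> g t < t"
      then have gt: "t < g t"
        using no_fix[OF that] by simp
      have "\<exists>r>\<zeta>\<^sub>2. g r - r = 0"
      proof (cases "t \<le> s")
        case True
        moreover have "continuous_on {t..s} (\<lambda>s. g s - s)"
          using that zeta by (intro cont') simp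
        ultimately obtain r where "t \<le> r" "g r - r = 0"
          using IVT2'[of "\<lambda>s. g s - s" s 0 t] gs gt by auto
        then show ?thesis
          using that by (intro exI[of _ r]) auto
      next
        case False
        moreover have "continuous_on {s..t} (\<lambda>s. g s - s)"
          using \<open>\<not> s \<le> \<zeta>\<^sub>2\<close> zeta by (intro cont') simp
        ultimately obtain r where "s \<le> r" "g r - r = 0"
          using IVT'[of "\<lambda>s. g s - s" s 0 t] gs gt by auto
        then show ?thesis
          using \<open>\<not> s \<le> \<zeta>\<^sub>2\<close> by (intro exI[of _ r]) auto
      qed
      then show False
        using no_fix by auto
    qed
    have "continuous_on {0..S} g"
      using cont by (rule continuous_on_subset) auto
    then have "\<exists>x\<in>{0..S}. \<forall>t\<in>{0..S}. g t \<le> g x"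
      using S(1) by (intro continuous_attains_sup) auto
    then obtain x where x: "x \<in> {0..S}" "\<And>t. t \<in> {0..S} \<Longrightarrow> g t \<le> g x"
      by blast
    have "S \<le> g x"
      using x(2) by (intro S(2)) auto
    have "\<zeta>\<^sub>2 < S"
      using False s by simp
    consider "x \<in> {0..\<zeta>\<^sub>1}" | "x \<in> {\<zeta>\<^sub>1..\<zeta>\<^sub>2}" | "\<zeta>\<^sub>2 < x"
      using x(1) by fastforce
    then have "g x < S"
    proof cases
      case 1
      then have "g x \<in> {0..\<zeta>\<^sub>2}"
        using inv(2) by blast
      then show ?thesis
        using \<open>\<zeta>\<^sub>2 < S\<close> by simp
    next
      case 2
      then have "g x \<in> {\<zeta>\<^sub>1..\<zeta>\<^sub>2}"
        using inv(1) by blast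
      then show ?thesis
        using \<open>\<zeta>\<^sub>2 < S\<close> by simp
    next
      case 3
      then show ?thesis
        using below[of x] x(1) by simp
    qed
    with \<open>S \<le> g x\<close> show False
      by simp
  qed
qed

theorem theorem3:
  fixes h p c \<zeta>\<^sub>1 \<zeta>\<^sub>2 \<kappa> :: real and K g \<phi> :: "real \<Rightarrow> real"
  assumes h_nonneg: "0 \<le> h"
    and K_nonneg: "\<And>s. 0 \<le> K s"
    and K_exp_moments: "\<And>\<mu>::real. integrable lebesgue (\<lambda>s. K s * exp (\<mu> * s))"
    and K_mass: "(LINT s|lebesgue. K s) = 1"
    and g_cont: "continuous_on {0..} g"
    and g_nonneg: "\<And>s. 0 \<le> s \<Longrightarrow> 0 \<le> g s"
    and g_pos: "\<And>s. 0 < s \<Longrightarrow> 0 < g s"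
    and zeta_order: "0 < \<zeta>\<^sub>1" "\<zeta>\<^sub>1 < \<zeta>\<^sub>2"
    and g_invariant: "g ` {\<zeta>\<^sub>1..\<zeta>\<^sub>2} \<subseteq> {\<zeta>\<^sub>1..\<zeta>\<^sub>2}" "g ` {0..\<zeta>\<^sub>1} \<subseteq> {0..\<zeta>\<^sub>2}"
    and g_min: "\<And>s. s \<in> {\<zeta>\<^sub>1..\<zeta>\<^sub>2} \<Longrightarrow> g \<zeta>\<^sub>1 \<le> g s"
    and g_above: "\<And>s. s \<in> {0<..\<zeta>\<^sub>1} \<Longrightarrow> s < g s"
    and g_deriv: "(g has_real_derivative p) (at 0 within {0..})" "1 < p"
    and g_fixpoints: "{s. 0 \<le> s \<and> g s = s} = {0, \<kappa>}" "\<kappa> \<noteq> 0"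
    and speed: "critical_speed h p 1 K < c"
    and sol: "classical_solution h K g (\<lambda>t x. \<phi> (x + c * t))"
    and phi_pos: "\<And>s. 0 < \<phi> s"
    and phi_bounded: "bounded (range \<phi>)"
  shows "ereal \<zeta>\<^sub>1 \<le> Liminf at_top (\<lambda>s. ereal (\<phi> s))
       \<and> Liminf at_top (\<lambda>s. ereal (\<phi> s)) \<le> ereal (SUP s. \<phi> s)
       \<and> (SUP s. \<phi> s) \<le> Sup (g ` {0..(SUP s. \<phi> s)})"
proof -
  define S where "S = (SUP s. \<phi> s)"
  have bdd: "bdd_above (range \<phi>)"
    using phi_bounded by (rule bounded_imp_bdd_above)
  have phi_le: "\<phi> s \<le> S" for s
    unfolding S_def using bdd by (intro cSUP_upper) auto
  have S0: "0 \<le> S"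
    using phi_pos[of 0] phi_le[of 0] by simp
  interpret base: exp_kernel K
    by standard (fact K_nonneg K_exp_moments K_mass)+
  interpret dispersion K h p 1
    by unfold_locales (use h_nonneg g_deriv in auto)
  have c: "0 < c"
    using speed by (rule supercritical_speed_pos)
  interpret kernel: exp_kernel "\<lambda>r. K (r - c * h)"
    by (rule base.translate)
  obtain \<phi>' \<phi>'' where profile:
    "\<And>s. (\<phi> has_real_derivative \<phi>' s) (at s)"
    "\<And>s. (\<phi>' has_real_derivative \<phi>'' s) (at s)"
    "\<And>s. \<phi>'' s - c * \<phi>' s - \<phi> s + (LINT r|lebesgue. K (r - c * h) * g (\<phi> (s - r))) = 0"
    using travelling_wave_profile[OF sol] by blast
  interpret wave_profile "\<lambda>r. K (r - c * h)" g \<phi> \<phi>' \<phi>'' c S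
    by unfold_locales (use c g_cont g_nonneg profile phi_pos phi_le in auto)
  have g0: "g 0 = 0"
    using g_fixpoints(1) by blast
  \<comment> \<open>Applied to the supremum, the maximum principle gives the last inequality of the
    claim and also the hypothesis on \<open>S\<close> in
    \<open>birth_function_beyond\<close>.\<close>
  have S_le: "S \<le> B" if "\<And>s. 0 \<le> s \<Longrightarrow> s \<le> S \<Longrightarrow> g s \<le> B" for B
    unfolding S_def by (rule cSUP_least) (use that profile_upper_bound in auto)
  have beyond: "\<zeta>\<^sub>1 < g s" if "\<zeta>\<^sub>1 \<le> s" "s \<le> S" for s
    by (rule birth_function_beyond[OF g_cont zeta_order g_invariant g_min _ g_fixpoints(1) S0 S_le that])
       (use g_above zeta_order in auto)
  obtain \<gamma> where \<gamma>: "1 < \<gamma>" "\<forall>s\<in>{0..S}. \<gamma> * min s \<zeta>\<^sub>1 \<le> g s"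
    using lower_bound_superlinear[OF g_cont g0 g_pos g_deriv zeta_order(1) g_above beyond] by auto
  \<comment> \<open>This is \<open>disp (- \<mu>) c > 0\<close>, rewritten for the translated
    kernel.\<close>
  have "0 < \<mu>\<^sup>2 + c * \<mu> - 1 + p * (LINT r|lebesgue. K (r - c * h) * exp (\<mu> * r))" if "0 \<le> \<mu>" for \<mu>
    using supercritical_disp_pos[OF speed, of "- \<mu>"] that
    by (simp add: disp_def base.integral_translate_exp mult.assoc)
  moreover have "\<exists>\<delta>>0. \<forall>s\<in>{0..S}. p' * min s \<delta> \<le> g s" if "0 < p'" "p' < p" for p'
    using lower_bound_from_derivative[OF g_cont g0 g_pos g_deriv(1) that] .
  ultimately obtain \<epsilon> where \<epsilon>: "0 < \<epsilon>" "\<epsilon> \<le> \<zeta>\<^sub>1" "\<And>s. 0 \<le> s \<Longrightarrow> \<epsilon> \<le> \<phi> s"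
    using persistence[of p \<zeta>\<^sub>1] p_pos zeta_order(1) by blast
  have "ereal \<zeta>\<^sub>1 \<le> Liminf at_top (\<lambda>s. ereal (\<phi> s))"
  \<comment> \<open>Only levels strictly below \<open>\<zeta>\<^sub>1\<close> are eventually
    exceeded, so the bound for the lower limit is reached by density.\<close>
  proof (rule dense_le)
    fix y assume "y < ereal \<zeta>\<^sub>1"
    then obtain \<zeta> where \<zeta>: "y < ereal \<zeta>" "ereal \<zeta> < ereal \<zeta>\<^sub>1"
      using ereal_dense2 by blast
    have "eventually (\<lambda>s. \<zeta> \<le> \<phi> s) at_top"
      by (rule eventually_above[OF \<gamma> \<epsilon>]) (use \<zeta>(2) in simp_all)
    then have "ereal \<zeta> \<le> Liminf at_top (\<lambda>s. ereal (\<phi> s))"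
      by (intro Liminf_bounded) (auto elim: eventually_mono)
    then show "y \<le> Liminf at_top (\<lambda>s. ereal (\<phi> s))"
      using \<zeta>(1) by simp
  qed
  moreover have "Liminf at_top (\<lambda>s. ereal (\<phi> s)) \<le> ereal S"
  proof -
    have "Liminf at_top (\<lambda>s. ereal (\<phi> s)) \<le> Limsup at_top (\<lambda>s. ereal (\<phi> s))"
      by (rule Liminf_le_Limsup) simp
    also have "\<dots> \<le> ereal S"
      by (rule Limsup_bounded) (simp add: phi_le)
    finally show ?thesis .
  qed
  moreover have "S \<le> Sup (g ` {0..S})"
  proof (rule S_le)
    fix s assume "0 \<le> s" "s \<le> S"
    moreover have "bdd_above (g ` {0..S})"
      using g_bounded by (auto intro: bdd_aboveI2)
    ultimately show "g s \<le> Sup (g ` {0..S})"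
      by (intro cSup_upper) auto
  qed
  ultimately show ?thesis
    unfolding S_def by blast
qed

end
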